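(* Let $X_1,X_2,\dots$ be real independent random variables with uniformly bounded third moments, $\sup_jE|X_j|^3<\infty$, with common mean $E(X_j)=m$ and common variance $\mathrm{Var}(X_j)=\sigma^2>0$. For each $n\ge1$ let $\mathbf A_n$ be the $n\times n$ symmetric random circulant matrix whose first row is given by $[\mathbf A_n]_{1,j}=X_j$ for $1\le j\le\lfloor n/2\rfloor+1$ (and $j\le n$), and $[\mathbf A_n]_{1,j}=[\mathbf A_n]_{1,n+2-j}$ for the remaining $j\le n$. Then, with probability $1$, the spectrum of $\frac1{\sigma\sqrt n}\mathbf A_n$ converges weakly to the standard normal law as $n\to\infty$.
   Context: An $n\times n$ matrix $A$ is circulant if its entry $A_{i,j}$ depends only on $(j-i)\bmod n$; it is then determined by its first row. Convergence of the spectrum means convergence of the empirical spectral measure: if $\lambda_1,\dots,\lambda_n$ are the (real) eigenvalues, with multiplicity, of $\frac1{\sigma\sqrt n}\mathbf A_n$, then the random probability measures $\frac1n\sum_{k=1}^n\delta_{\lambda_k}$ converge weakly to $N(0,1)$. *)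

theory Defs
  imports "HOL-Probability.Probability" "Jordan_Normal_Form.Char_Poly"
begin

definition circulant_mat :: "'a mat \<Rightarrow> bool" where
  "circulant_mat A \<longleftrightarrow> square_mat A \<and>
     (\<forall>i < dim_row A. \<forall>j < dim_row A. \<forall>i' < dim_row A. \<forall>j' < dim_row A.
        (int j - int i) mod int (dim_row A) = (int j' - int i') mod int (dim_row A)
        \<longrightarrow> A $$ (i, j) = A $$ (i', j'))"

(* The first row is numbered 1, ..., n, whereas matrix indices start at 0:
   entry (0, k) of the matrix is r (k + 1). *)
definition circulant_of_row :: "nat \<Rightarrow> (nat \<Rightarrow> 'a) \<Rightarrow> 'a mat" where
  "circulant_of_row n r = mat n n (\<lambda>(i, j). r (nat ((int j - int i) mod int n) + 1))"

(* For n div 2 + 1 < j <= n the index n + 2 - j lies in {2..n div 2 + 1}. *)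
definition sym_row :: "nat \<Rightarrow> (nat \<Rightarrow> 'a) \<Rightarrow> nat \<Rightarrow> 'a" where
  "sym_row n x j = (if j \<le> n div 2 + 1 then x j else x (n + 2 - j))"

definition sym_circulant :: "nat \<Rightarrow> (nat \<Rightarrow> 'a) \<Rightarrow> 'a mat" where
  "sym_circulant n x = circulant_of_row n (sym_row n x)"

(* The measure (1/n) (delta_1 + ... + delta_n), with the point masses at the eigenvalues, for an
   n x n matrix whose eigenvalues are all real (such as a symmetric one): the multiset of roots of
   the characteristic polynomial lists the real eigenvalues with algebraic multiplicity. *)
definition empirical_spectral_measure :: "real mat \<Rightarrow> real measure" where
  "empirical_spectral_measure A =
     measure_of UNIV (sets borel)
       (\<lambda>B. ennreal ((\<Sum>x\<in>#proots (char_poly A). indicator B x) / real (dim_row A)))"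

lemma sym_circulant_carrier: "sym_circulant n x \<in> carrier_mat n n"
  by (simp add: sym_circulant_def circulant_of_row_def)

lemma circulant_sym_circulant: "circulant_mat (sym_circulant n x)"
  by (simp add: circulant_mat_def sym_circulant_def circulant_of_row_def)

lemma sym_circulant_first_row:
  assumes "1 \<le> j" "j \<le> n"
  shows "sym_circulant n x $$ (0, j - 1) = sym_row n x j"
  using assms by (simp add: sym_circulant_def circulant_of_row_def nat_mod_distrib)

lemma sym_circulant_first_row_reflect:
  assumes "n div 2 + 1 < j" "j \<le> n"
  shows "sym_circulant n x $$ (0, j - 1) = sym_circulant n x $$ (0, (n + 2 - j) - 1)"
proof -
  have "1 \<le> n + 2 - j" "n + 2 - j \<le> n" "n + 2 - j \<le> n div 2 + 1"
    using assms by linarith+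
  then show ?thesis
    using assms
    by (subst (1 2) sym_circulant_first_row) (auto simp: sym_row_def)
qed

lemma sym_row_reflect:
  assumes "2 \<le> j" "j \<le> n"
  shows "sym_row n x (n + 2 - j) = sym_row n x j"
proof -
  consider "j \<le> n div 2 + 1" "n + 2 - j \<le> n div 2 + 1" | "j > n div 2 + 1"
    | "n + 2 - j > n div 2 + 1" by linarith
  then show ?thesis
  proof cases
    case 1
    then have "n + 2 - j = j" by linarith
    then show ?thesis by simp
  next
    case 2
    then have "n + 2 - j \<le> n div 2 + 1" by linarith
    with 2 show ?thesis by (simp add: sym_row_def)
  next
    case 3
    then have "j \<le> n div 2 + 1" by linarith
    moreover have "n + 2 - (n + 2 - j) = j" using assms by simp
    ultimately show ?thesis using 3 by (simp add: sym_row_def)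
  qed
qed

lemma sym_circulant_symmetric: "transpose_mat (sym_circulant n x) = sym_circulant n x"
proof (rule eq_matI)
  fix i j
  assume "i < dim_row (sym_circulant n x)" "j < dim_col (sym_circulant n x)"
  then have ij: "i < n" "j < n" by (simp_all add: sym_circulant_def circulant_of_row_def)
  define d where "d = nat ((int j - int i) mod int n)"
  define e where "e = nat ((int i - int j) mod int n)"
  have n: "0 < n" using ij by simp
  have neg: "(int i - int j) mod int n =
      (if (int j - int i) mod int n = 0 then 0 else int n - (int j - int i) mod int n)"
    using zmod_zminus1_eq_if[of "int j - int i" "int n"] by simp
  have bnd: "0 \<le> (int j - int i) mod int n" "(int j - int i) mod int n < int n"
    using n by simp_all
  have "sym_row n x (e + 1) = sym_row n x (d + 1)"
  proof (cases "d = 0")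
    case True
    then have "e = 0" using neg bnd by (auto simp: d_def e_def)
    with True show ?thesis by simp
  next
    case False
    then have "e + 1 = n + 2 - (d + 1)" "2 \<le> d + 1" "d + 1 \<le> n"
      using neg bnd by (auto simp: d_def e_def)
    then show ?thesis using sym_row_reflect[of "d + 1" n x] by simp
  qed
  with ij show "transpose_mat (sym_circulant n x) $$ (i, j) = sym_circulant n x $$ (i, j)"
    by (simp add: sym_circulant_def circulant_of_row_def d_def e_def)
qed (simp_all add: sym_circulant_def circulant_of_row_def)

lemma sets_empirical_spectral_measure [simp]: "sets (empirical_spectral_measure A) = sets borel"
  by (simp add: empirical_spectral_measure_def sets.sigma_sets_eq[of borel, simplified])

lemma emeasure_empirical_spectral_measure:
  assumes "B \<in> sets borel"
  shows "emeasure (empirical_spectral_measure A) B =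
    ennreal ((\<Sum>x\<in>#proots (char_poly A). indicator B x) / real (dim_row A))"
proof -
  let ?f = "\<lambda>(R :: real multiset) (B :: real set). \<Sum>x\<in>#R. indicator B x :: real"
  let ?n = "real (dim_row A)"
  have nonneg: "0 \<le> ?f R B" for R B
    by (induction R) auto
  have sums: "(\<lambda>i. ?f R (F i)) sums ?f R (\<Union>i. F i)"
    if "disjoint_family F" for R and F :: "nat \<Rightarrow> real set"
  proof (induction R)
    case (add a R)
    have "(\<lambda>i. indicator (F i) a) sums (indicator (\<Union>i. F i) a :: real)"
      using that by (intro indicator_sums) (auto simp: disjoint_family_on_def)
    from sums_add[OF this add.IH] show ?case by simp
  qed simp
  have "countably_additive (sets borel) (\<lambda>B. ennreal (?f (proots (char_poly A)) B / ?n))"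
  proof (rule countably_additiveI)
    fix F :: "nat \<Rightarrow> real set"
    assume "disjoint_family F"
    from sums_divide[OF sums[OF this], of "proots (char_poly A)" ?n]
    show "(\<Sum>i. ennreal (?f (proots (char_poly A)) (F i) / ?n)) =
        ennreal (?f (proots (char_poly A)) (\<Union>i. F i) / ?n)"
      by (intro suminf_ennreal_eq) (auto simp: nonneg)
  qed
  moreover have "sigma_algebra UNIV (sets (borel :: real measure))"
    using sets.sigma_algebra_axioms[of "borel :: real measure"] by simp
  moreover have "positive (sets borel) (\<lambda>B. ennreal (?f (proots (char_poly A)) B / ?n))"
  proof -
    have "?f R {} = 0" for R by (induction R) auto
    then show ?thesis by (simp only: positive_def div_0 ennreal_0)
  qed
  ultimately show ?thesis
    unfolding empirical_spectral_measure_def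
    using assms by (intro emeasure_measure_of_sigma)
qed

end

theory Submission
  imports Defs "HOL-Real_Asymp.Real_Asymp"
begin

text \<open>
  The eigenvalues of the symmetric circulant matrix with first row $c_0,\dots,c_{n-1}$ are the
  cosine sums $\lambda_k = \sum_d c_d \cos (2\pi dk/n)$ (lemma \<open>char_poly_sym_circulant\<close>), so the
  spectrum is an explicit linear image of the random entries, and by Parseval this map is $\sqrt n$
  times an isometry, up to the repetition of the entries. The convergence of the spectral measure
  splits into convergence of its mean and concentration around its mean.

  The mean. For each frequency with $n \nmid 2k$ the eigenvalue is a sum of independent variables with
  bounded coefficients. The coefficients sum to zero, which removes the common mean $m$, and their squares sum to
  $n + O(1)$. The classical characteristic function argument therefore gives $N(0,1)$ in the limit, with
  bounds that are uniform in $k$ (lemma \<open>circ_eig_clt\<close>); at most two frequencies are exceptional,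
  and they carry mass at most $2/n$.

  Concentration. Almost sure convergence needs summable deviation probabilities, since matrices
  of different sizes sample the trigonometric sums at different frequencies, and control along a sparse
  subsequence of sizes would not carry over to the sizes in between.
  For the hinge $u \mapsto \max(0, u - c)$ the average over the spectrum is a \<^emph>\<open>convex\<close> function of
  the entries, and Parseval shows that it is Lipschitz in the Euclidean norm with constant
  $\sqrt 2/(\sigma\sqrt n)$. Maurey's inequality (lemma \<open>maurey_product\<close>) gives
  Gaussian concentration for convex Lipschitz functions of independent bounded variables
  (lemma \<open>convex_concentration\<close>). With the entry $X_j$ cut off at $j^{2/5}$ the
  deviation probabilities are at most $2\exp (-c\,n^{1/5})$. The third moments make the cut-off harmless: since
  $\sum_j j^{-6/5} < \infty$, almost surely only finitely many entries are changed, and the change in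
  mean is negligible as well.

  A piecewise linear step is built from two hinges, and the steps with rational end points
  determine the limit of the distribution functions.
\<close>

section \<open>The spectrum of a symmetric circulant matrix\<close>

text \<open>
  The eigenvalue of the symmetric circulant matrix at the frequency $k/n$. By symmetry of the row the
  sine part of the discrete Fourier transform vanishes.
\<close>

definition circ_eig :: "nat \<Rightarrow> (nat \<Rightarrow> real) \<Rightarrow> nat \<Rightarrow> real" where
  "circ_eig n x k = (\<Sum>d<n. sym_row n x (d + 1) * cos (2 * pi * real d * real k / real n))"

lemma sum_cis_multiples:
  assumes "n > 0"
  shows "(\<Sum>j<n. cis (2 * pi * real j * of_int m / real n)) = (if int n dvd m then of_nat n else 0)"
proof -
  define z where "z = cis (2 * pi * of_int m / real n)"
  have pow: "cis (2 * pi * real j * of_int m / real n) = z ^ j" for j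
  proof -
    have "2 * pi * real j * of_int m / real n = real j * (2 * pi * of_int m / real n)" by simp
    then show ?thesis unfolding z_def by (simp only: Complex.DeMoivre)
  qed
  have zn: "z ^ n = 1"
    using assms cis_multiple_2pi[of "of_int m"] by (simp add: z_def Complex.DeMoivre mult.assoc)
  have z1: "z = 1 \<longleftrightarrow> int n dvd m"
  proof
    assume "z = 1"
    then have "cos (2 * pi * of_int m / real n) = 1"
      by (simp add: z_def cis.ctr complex_eq_iff)
    then obtain q :: int where "2 * pi * of_int m / real n = of_int q * 2 * pi"
      by (auto simp: cos_one_2pi_int)
    then have "real_of_int m = of_int q * real n"
      using assms by (simp add: field_simps)
    then have "m = q * int n"
      by (metis of_int_eq_iff of_int_mult of_int_of_nat_eq)
    then show "int n dvd m" by simp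
  next
    assume "int n dvd m"
    then obtain q where "m = int n * q" by auto
    then have "2 * pi * of_int m / real n = 2 * pi * of_int q"
      using assms by simp
    then show "z = 1" by (simp add: z_def cis_multiple_2pi)
  qed
  show ?thesis
    unfolding pow using z1 zn by (simp add: sum_gp_strict)
qed

lemma sum_cos_multiples:
  assumes "n > 0"
  shows "(\<Sum>j<n. cos (2 * pi * real j * of_int m / real n)) = (if int n dvd m then real n else 0)"
  using arg_cong[OF sum_cis_multiples[OF assms, of m], of Re] by (auto simp: Re_sum)

lemma sum_sin_multiples:
  assumes "n > 0"
  shows "(\<Sum>j<n. sin (2 * pi * real j * of_int m / real n)) = 0"
  using arg_cong[OF sum_cis_multiples[OF assms, of m], of Im] by (auto simp: Im_sum split: if_splits)

text \<open>
  The kernel of the discrete Hartley transform. It is a real symmetric substitute for the Fourier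
  kernel, orthogonal up to the factor $n$, which diagonalises all \<^emph>\<open>symmetric\<close> circulant matrices and
  keeps the whole spectral computation over the reals.
\<close>

definition hartley :: "nat \<Rightarrow> nat \<Rightarrow> nat \<Rightarrow> real" where
  "hartley n j k = cos (2 * pi * real j * real k / real n) + sin (2 * pi * real j * real k / real n)"

lemma hartley_commute: "hartley n j k = hartley n k j"
  by (simp add: hartley_def mult_ac)

text \<open>
  The product of the kernels at $(i,j)$ and $(j,k)$ is
  $\cos (2\pi j(i-k)/n) + \sin (2\pi j(i+k)/n)$, so this reduces to sums over roots of unity.
\<close>

lemma hartley_orthogonal:
  assumes "i < n" "k < n"
  shows "(\<Sum>j<n. hartley n i j * hartley n j k) = (if i = k then real n else 0)"
proof -
  have n: "n > 0" using assms by simp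
  have prod: "hartley n i j * hartley n j k =
      cos (2 * pi * real j * of_int (int i - int k) / real n)
      + sin (2 * pi * real j * of_int (int i + int k) / real n)" for j
  proof -
    have 1: "2 * pi * real j * of_int (int i - int k) / real n
        = 2 * pi * real i * real j / real n - 2 * pi * real j * real k / real n"
      and 2: "2 * pi * real j * of_int (int i + int k) / real n
        = 2 * pi * real i * real j / real n + 2 * pi * real j * real k / real n"
      by (simp_all add: algebra_simps diff_divide_distrib add_divide_distrib)
    show ?thesis
      unfolding 1 2 hartley_def cos_diff sin_add by (simp add: algebra_simps)
  qed
  have "int n dvd int i - int k \<longleftrightarrow> i = k"
  proof
    assume "int n dvd int i - int k"
    moreover have "\<bar>int i - int k\<bar> < int n" using assms by linarith
    ultimately have "int i - int k = 0"
      using zdvd_not_zless[of "\<bar>int i - int k\<bar>" "int n"] by force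
    then show "i = k" by simp
  qed simp
  then show ?thesis
    unfolding prod sum.distrib sum_cos_multiples[OF n] sum_sin_multiples[OF n] by simp
qed

lemma sum_reflect_odd:
  fixes c s :: "nat \<Rightarrow> real"
  assumes c: "\<And>d. 0 < d \<Longrightarrow> d < n \<Longrightarrow> c (n - d) = c d"
    and s: "\<And>d. 0 < d \<Longrightarrow> d < n \<Longrightarrow> s (n - d) = - s d" and "s 0 = 0"
  shows "(\<Sum>d<n. c d * s d) = 0"
proof (cases "n = 0")
  case False
  have "(\<Sum>d<n. c d * s d) = (\<Sum>d\<in>{0<..<n}. c d * s d)"
    using False \<open>s 0 = 0\<close> by (intro sum.mono_neutral_right) auto
  also have "\<dots> = (\<Sum>d\<in>{0<..<n}. c (n - d) * s (n - d))"
    by (rule sum.reindex_bij_witness[of _ "\<lambda>d. n - d" "\<lambda>d. n - d"]) auto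
  also have "\<dots> = (\<Sum>d\<in>{0<..<n}. - (c d * s d))"
    by (intro sum.cong) (auto simp: c s)
  finally have "(\<Sum>d\<in>{0<..<n}. c d * s d) = 0" "(\<Sum>d<n. c d * s d) = (\<Sum>d\<in>{0<..<n}. c d * s d)"
    by (simp_all add: sum_negf \<open>(\<Sum>d<n. c d * s d) = (\<Sum>d\<in>{0<..<n}. c d * s d)\<close>)
  then show ?thesis by simp
qed simp

lemma sin_reflect: "0 < d \<Longrightarrow> d < n \<Longrightarrow>
   sin (2 * pi * real (n - d) * real k / real n) = - sin (2 * pi * real d * real k / real n)"
proof -
  assume "0 < d" "d < n"
  then have "2 * pi * real (n - d) * real k / real n = 2 * pi * of_int (int k) - 2 * pi * real d * real k / real n"
    by (simp add: of_nat_diff field_simps)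
  then show ?thesis by (simp only: sin_diff sin_int_2pin cos_int_2pin mult_zero_left mult_1 diff_0)
qed

lemma sym_row_Suc_reflect: "0 < d \<Longrightarrow> d < n \<Longrightarrow> sym_row n x (n - d + 1) = sym_row n x (d + 1)"
  using sym_row_reflect[of "d + 1" n x] by (simp add: Suc_diff_le)

lemma circ_eig_hartley: "circ_eig n x k = (\<Sum>d<n. sym_row n x (d + 1) * hartley n d k)"
proof -
  have "(\<Sum>d<n. sym_row n x (d + 1) * sin (2 * pi * real d * real k / real n)) = 0"
    by (intro sum_reflect_odd) (auto simp only: sym_row_Suc_reflect sin_reflect, simp_all)
  then show ?thesis
    by (simp add: circ_eig_def hartley_def distrib_left sum.distrib)
qed

text \<open>
  The vector of eigenvalues is the Hartley transform of the first row.
\<close>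

lemma circ_eig_parseval:
  "(\<Sum>k<n. (circ_eig n x k)\<^sup>2) = real n * (\<Sum>d<n. (sym_row n x (d + 1))\<^sup>2)"
proof -
  have "(\<Sum>k<n. (circ_eig n x k)\<^sup>2)
      = (\<Sum>k<n. \<Sum>d<n. \<Sum>e<n. sym_row n x (d + 1) * sym_row n x (e + 1) * (hartley n d k * hartley n k e))"
    unfolding circ_eig_hartley power2_eq_square sum_product
    by (intro sum.cong refl) (simp add: hartley_commute)
  also have "\<dots> = (\<Sum>d<n. \<Sum>k<n. \<Sum>e<n. sym_row n x (d + 1) * sym_row n x (e + 1) * (hartley n d k * hartley n k e))"
    by (rule sum.swap)
  also have "\<dots> = (\<Sum>d<n. \<Sum>e<n. \<Sum>k<n. sym_row n x (d + 1) * sym_row n x (e + 1) * (hartley n d k * hartley n k e))"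
    by (intro sum.cong refl sum.swap)
  also have "\<dots> = (\<Sum>d<n. \<Sum>e<n. sym_row n x (d + 1) * sym_row n x (e + 1) * (\<Sum>k<n. hartley n d k * hartley n k e))"
    by (simp only: sum_distrib_left)
  also have "\<dots> = (\<Sum>d<n. \<Sum>e<n. if d = e then sym_row n x (d + 1) * sym_row n x (d + 1) * real n else 0)"
    by (intro sum.cong refl) (simp add: hartley_orthogonal)
  also have "\<dots> = real n * (\<Sum>d<n. (sym_row n x (d + 1))\<^sup>2)"
    by (simp add: sum.delta sum_distrib_left power2_eq_square mult_ac)
  finally show ?thesis .
qed

lemma sum_cyclic_shift:
  fixes f :: "nat \<Rightarrow> real"
  assumes "i < n"
  shows "(\<Sum>j<n. f j) = (\<Sum>d<n. f ((i + d) mod n))"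
proof (rule sum.reindex_bij_witness[of _ "\<lambda>d. (i + d) mod n" "\<lambda>j. (n - i + j) mod n"])
  fix j assume "j \<in> {..<n}"
  have "(i + (n - i + j) mod n) mod n = (i + (n - i + j)) mod n" by (simp add: mod_add_right_eq)
  also have "i + (n - i + j) = j + n" using assms by simp
  finally show "(i + (n - i + j) mod n) mod n = j" using \<open>j \<in> {..<n}\<close> by simp
  then show "f ((i + (n - i + j) mod n) mod n) = f j" by simp
next
  fix d assume "d \<in> {..<n}"
  have "(n - i + (i + d) mod n) mod n = (n - i + (i + d)) mod n" by (simp add: mod_add_right_eq)
  also have "n - i + (i + d) = d + n" using assms by simp
  finally show "(n - i + (i + d) mod n) mod n = d" using \<open>d \<in> {..<n}\<close> by simp
qed auto

lemma cos_sin_mod: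
  assumes "n > 0"
  shows "cos (2 * pi * real (j mod n) * real k / real n) = cos (2 * pi * real j * real k / real n)"
    and "sin (2 * pi * real (j mod n) * real k / real n) = sin (2 * pi * real j * real k / real n)"
proof -
  have "real j = real (j mod n) + real n * real (j div n)"
    by (metis add.commute mult_div_mod_eq of_nat_add of_nat_mult)
  then have "2 * pi * real j * real k / real n
      = 2 * pi * real (j mod n) * real k / real n + 2 * pi * of_int (int (j div n * k))"
    using assms by (simp add: field_simps)
  then have "cis (2 * pi * real j * real k / real n) = cis (2 * pi * real (j mod n) * real k / real n)"
    using cis_multiple_2pi[of "of_int (int (j div n * k))"] by (simp only: cis_mult[symmetric]) simp
  then show "cos (2 * pi * real (j mod n) * real k / real n) = cos (2 * pi * real j * real k / real n)"
    and "sin (2 * pi * real (j mod n) * real k / real n) = sin (2 * pi * real j * real k / real n)"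
    by (simp_all add: complex_eq_iff)
qed

text \<open>
  The addition theorem splits the shifted kernel into a multiple of $\sum_d c_d\cos (2\pi dk/n)$ and a multiple of
  $\sum_d c_d\sin (2\pi dk/n)$; the latter is zero because the row is symmetric.
\<close>

lemma hartley_eigenvector:
  assumes "i < n" 
  shows "(\<Sum>j<n. sym_circulant n x $$ (i, j) * hartley n j k) = hartley n i k * circ_eig n x k"
proof -
  have n: "n > 0" using assms by simp
  let ?t = "\<lambda>d. 2 * pi * real d * real k / real n"
  have entry: "sym_circulant n x $$ (i, (i + d) mod n) = sym_row n x (d + 1)" if "d < n" for d
  proof -
    have "(int ((i + d) mod n) - int i) mod int n = (int (i + d) - int i) mod int n"
      by (simp add: of_nat_mod mod_diff_left_eq)
    also have "\<dots> = int d" using that by simp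
    finally show ?thesis
      using assms n by (simp add: sym_circulant_def circulant_of_row_def)
  qed
  have "(\<Sum>j<n. sym_circulant n x $$ (i, j) * hartley n j k)
      = (\<Sum>d<n. sym_row n x (d + 1) * (cos (?t (i + d)) + sin (?t (i + d))))"
    by (subst sum_cyclic_shift[OF assms]) (simp add: entry hartley_def cos_sin_mod[OF n] del: of_nat_add)
  also have "\<dots> = (\<Sum>d<n. hartley n i k * (sym_row n x (d + 1) * cos (?t d))
       + (cos (?t i) - sin (?t i)) * (sym_row n x (d + 1) * sin (?t d)))"
  proof (intro sum.cong refl)
    fix d
    have "?t (i + d) = ?t i + ?t d" by (simp add: algebra_simps add_divide_distrib)
    then show "sym_row n x (d + 1) * (cos (?t (i + d)) + sin (?t (i + d))) =
      hartley n i k * (sym_row n x (d + 1) * cos (?t d))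
       + (cos (?t i) - sin (?t i)) * (sym_row n x (d + 1) * sin (?t d))"
      by (simp only: cos_add sin_add hartley_def) (simp add: algebra_simps)
  qed
  also have "\<dots> = hartley n i k * circ_eig n x k
       + (cos (?t i) - sin (?t i)) * (\<Sum>d<n. sym_row n x (d + 1) * sin (?t d))"
    by (simp add: sum.distrib sum_distrib_left circ_eig_def)
  also have "(\<Sum>d<n. sym_row n x (d + 1) * sin (?t d)) = 0"
    by (intro sum_reflect_odd) (auto simp only: sym_row_Suc_reflect sin_reflect, simp_all)
  finally show ?thesis by simp
qed

text \<open>
  The Hartley matrix conjugates the circulant matrix to a diagonal one.
\<close>

lemma char_poly_sym_circulant:
  "char_poly (sym_circulant n x) = (\<Prod>k<n. [:- circ_eig n x k, 1:])"
proof (cases "n = 0")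
  case True
  then show ?thesis
    using char_poly_upper_triangular[OF sym_circulant_carrier, of n x]
    by (simp add: diag_mat_def sym_circulant_def circulant_of_row_def upper_triangular_def)
next
  case False
  define H where "H = mat n n (\<lambda>(j, k). hartley n j k)"
  define D where "D = mat n n (\<lambda>(j, k). if j = k then circ_eig n x k else 0)"
  define Hi where "Hi = (1 / real n) \<cdot>\<^sub>m H"
  let ?A = "sym_circulant n x"
  have car: "H \<in> carrier_mat n n" "D \<in> carrier_mat n n" "Hi \<in> carrier_mat n n" "?A \<in> carrier_mat n n"
    by (simp_all add: H_def D_def Hi_def sym_circulant_carrier)
  have HH: "H * H = real n \<cdot>\<^sub>m 1\<^sub>m n"
    by (rule eq_matI)
      (auto simp: H_def scalar_prod_def hartley_orthogonal lessThan_atLeast0[symmetric])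
  have inv: "H * Hi = 1\<^sub>m n" "Hi * H = 1\<^sub>m n"
    using False HH car
    by (auto simp: Hi_def mult_smult_distrib[OF car(1) car(1)] mult_smult_assoc_mat[OF car(1) car(1)] intro!: eq_matI)
  have "?A * H = H * D"
  proof (rule eq_matI)
    fix i k assume "i < dim_row (H * D)" "k < dim_col (H * D)"
    then have ik: "i < n" "k < n" by (simp_all add: H_def D_def)
    have "(?A * H) $$ (i, k) = (\<Sum>j<n. ?A $$ (i, j) * hartley n j k)"
      using ik car by (simp add: scalar_prod_def H_def lessThan_atLeast0 carrier_matD[OF car(4)])
    also have "\<dots> = (\<Sum>j<n. if j = k then hartley n i j * circ_eig n x k else 0)"
      using ik by (simp add: hartley_eigenvector sum.delta)
    also have "\<dots> = (H * D) $$ (i, k)"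
      using ik by (simp add: scalar_prod_def H_def D_def lessThan_atLeast0 if_distrib cong: if_cong)
    finally show "(?A * H) $$ (i, k) = (H * D) $$ (i, k)" .
  qed (use car in auto)
  then have "?A * H * Hi = H * D * Hi" by simp
  then have "?A = H * D * Hi"
    using car inv by (simp add: assoc_mult_mat[OF car(4,1,3)])
  then have "similar_mat ?A D"
    using car inv by (intro similar_matI[of _ _ H Hi n]) auto
  then have "char_poly ?A = char_poly D" by (rule char_poly_similar)
  also have "\<dots> = (\<Prod>a\<leftarrow>diag_mat D. [:- a, 1:])"
    by (rule char_poly_upper_triangular[OF car(2)]) (auto simp: D_def upper_triangular_def)
  also have "diag_mat D = map (circ_eig n x) [0..<n]"
    by (auto simp: diag_mat_def D_def)
  also have "(\<Prod>a\<leftarrow>map (circ_eig n x) [0..<n]. [:- a, 1:]) = (\<Prod>k<n. [:- circ_eig n x k, 1:])"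
    by (simp add: prod.list_conv_set_nth lessThan_atLeast0)
  finally show ?thesis .
qed

lemma proots_sym_circulant:
  "proots (char_poly (sym_circulant n x)) = image_mset (circ_eig n x) (mset_set {..<n})"
proof -
  have "proots (char_poly (sym_circulant n x)) = (\<Sum>k<n. {#circ_eig n x k#})"
    unfolding char_poly_sym_circulant by (subst proots_prod) auto
  also have "(\<Sum>k<m. {#circ_eig n x k#}) = image_mset (circ_eig n x) (mset_set {..<m})" for m
    by (induction m) (auto simp: lessThan_Suc)
  finally show ?thesis .
qed

lemma sym_row_scale: "sym_row n (\<lambda>j. s * x j) d = s * sym_row n x d"
  by (simp add: sym_row_def)

lemma smult_sym_circulant: "s \<cdot>\<^sub>m sym_circulant n x = sym_circulant n (\<lambda>j. s * x j)"
  by (rule eq_matI) (auto simp: sym_circulant_def circulant_of_row_def sym_row_scale)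

lemma circ_eig_scale: "circ_eig n (\<lambda>j. s * x j) k = s * circ_eig n x k"
  by (simp add: circ_eig_def sym_row_scale sum_distrib_left mult.assoc)

lemma cdf_empirical_spectral_measure:
  "cdf (empirical_spectral_measure (s \<cdot>\<^sub>m sym_circulant n x)) t
     = (\<Sum>k<n. indicator {..t} (s * circ_eig n x k)) / real n"
proof -
  have "dim_row (sym_circulant n x) = n" for x :: "nat \<Rightarrow> real"
    by (rule carrier_matD(1)[OF sym_circulant_carrier])
  then have "emeasure (empirical_spectral_measure (s \<cdot>\<^sub>m sym_circulant n x)) {..t} =
      ennreal ((\<Sum>k<n. indicator {..t} (s * circ_eig n x k)) / real n)"
    unfolding smult_sym_circulant
    by (subst emeasure_empirical_spectral_measure)
      (simp_all add: proots_sym_circulant circ_eig_scale image_mset.compositionality comp_def sum_unfold_sum_mset)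
  then show ?thesis
    by (simp add: cdf_def measure_def sum_nonneg)
qed

section \<open>Eigenvalues as weighted sums of the independent entries\<close>

text \<open>
  A sequence with the symmetry of the first row can be folded onto the indices of the independent
  entries. Every entry occurs twice in the row except the first one and, for even $n$, the middle one.
  The index $j$ is the one-based column, hence $j - 1$.
\<close>

lemma sum_reflect_fold:
  fixes h :: "nat \<Rightarrow> real"
  assumes n: "n > 0" and h: "\<And>d. 0 < d \<Longrightarrow> d < n \<Longrightarrow> h (n - d) = h d"
  shows "(\<Sum>d<n. h d) = (\<Sum>j=1..n div 2 + 1. (if j = 1 \<or> 2 * (j - 1) = n then 1 else 2) * h (j - 1))"
proof -
  let ?T = "{d \<in> {..n div 2}. d \<noteq> 0 \<and> 2 * d \<noteq> n}"
  have eq: "{..<n} = {..n div 2} \<union> {n div 2<..<n}"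
  proof (rule Set.set_eqI)
    fix d
    have "n div 2 < n" using n by simp
    then show "d \<in> {..<n} \<longleftrightarrow> d \<in> {..n div 2} \<union> {n div 2<..<n}"
      unfolding Un_iff lessThan_iff atMost_iff greaterThanLessThan_iff by linarith
  qed
  have "(\<Sum>d<n. h d) = (\<Sum>d\<le>n div 2. h d) + (\<Sum>d\<in>{n div 2<..<n}. h d)"
    unfolding eq by (rule sum.union_disjoint) auto
  also have "(\<Sum>d\<in>{n div 2<..<n}. h d) = (\<Sum>d\<in>?T. h d)"
    by (rule sum.reindex_bij_witness[of _ "\<lambda>d. n - d" "\<lambda>d. n - d"]) (auto simp: h)
  also have "\<dots> = (\<Sum>d\<le>n div 2. if d \<noteq> 0 \<and> 2 * d \<noteq> n then h d else 0)"
    by (rule sum.inter_filter) simp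
  also have "(\<Sum>d\<le>n div 2. h d) + \<dots> = (\<Sum>d\<le>n div 2. (if d = 0 \<or> 2 * d = n then 1 else 2) * h d)"
    unfolding sum.distrib[symmetric] by (intro sum.cong) auto
  also have "\<dots> = (\<Sum>j=1..n div 2 + 1. (if j = 1 \<or> 2 * (j - 1) = n then 1 else 2) * h (j - 1))"
    by (rule sum.reindex_bij_witness[of _ "\<lambda>j. j - 1" "\<lambda>d. d + 1"]) auto
  finally show ?thesis .
qed

text \<open>
  The coefficient of the entry $X_j$ in the eigenvalue at frequency $k/n$; the factor counts how
  often $X_j$ occurs in the first row.
\<close>

definition circ_coeff :: "nat \<Rightarrow> nat \<Rightarrow> nat \<Rightarrow> real" where
  "circ_coeff n k j = (if j = 1 \<or> 2 * (j - 1) = n then 1 else 2) * cos (2 * pi * real (j - 1) * real k / real n)"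

lemma abs_circ_coeff_le: "\<bar>circ_coeff n k j\<bar> \<le> 2"
  using abs_cos_le_one[of "2 * pi * real (j - 1) * real k / real n"]
  by (auto simp: circ_coeff_def abs_mult)

lemma cos_reflect: "0 < d \<Longrightarrow> d < n \<Longrightarrow>
   cos (2 * pi * real (n - d) * real k / real n) = cos (2 * pi * real d * real k / real n)"
proof -
  assume "0 < d" "d < n"
  then have "2 * pi * real (n - d) * real k / real n = 2 * pi * of_int (int k) - 2 * pi * real d * real k / real n"
    by (simp add: of_nat_diff field_simps)
  then show ?thesis by (simp only: cos_diff sin_int_2pin cos_int_2pin mult_zero_left mult_1 add_0_right)
qed

lemma sum_cos_eq_circ_coeff:
  assumes "n > 0"
  shows "(\<Sum>d<n. cos (2 * pi * real d * real k / real n)) = (\<Sum>j=1..n div 2 + 1. circ_coeff n k j)"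
  using sum_reflect_fold[OF assms, of "\<lambda>d. cos (2 * pi * real d * real k / real n)"] cos_reflect
  by (simp add: circ_coeff_def)

lemma circ_eig_coeff:
  assumes n: "n > 0"
  shows "circ_eig n x k = (\<Sum>j=1..n div 2 + 1. circ_coeff n k j * x j)"
proof -
  have "circ_eig n x k = (\<Sum>j=1..n div 2 + 1. (if j = 1 \<or> 2 * (j - 1) = n then 1 else 2) *
      (sym_row n x (j - 1 + 1) * cos (2 * pi * real (j - 1) * real k / real n)))"
    unfolding circ_eig_def
    by (rule sum_reflect_fold[OF n]) (simp only: sym_row_Suc_reflect cos_reflect)
  also have "\<dots> = (\<Sum>j=1..n div 2 + 1. circ_coeff n k j * x j)"
    by (intro sum.cong) (auto simp: circ_coeff_def sym_row_def)
  finally show ?thesis .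
qed

lemma sum_circ_coeff:
  assumes "n > 0" "\<not> n dvd k"
  shows "(\<Sum>j=1..n div 2 + 1. circ_coeff n k j) = 0"
  unfolding sum_cos_eq_circ_coeff[OF assms(1), symmetric]
  using sum_cos_multiples[OF assms(1), of "int k"] assms by simp

text \<open>
  The coefficients sum to zero at every frequency other than zero.
\<close>

lemma circ_eig_shift:
  assumes "n > 0" "\<not> n dvd k"
  shows "circ_eig n (\<lambda>j. x j - m) k = circ_eig n x k"
  unfolding circ_eig_coeff[OF assms(1)] right_diff_distrib sum_subtractf
    sum_distrib_right[symmetric] sum_circ_coeff[OF assms] by simp

text \<open>
  A multiplicity $w \in \{1,2\}$ satisfies $w^2 = 2w - [w = 1]$. The sum of the squared cosines weighted by $w$ is
  $\sum_{d<n}\cos^2 (2\pi dk/n) = n/2$, and at most two columns have $w = 1$.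
\<close>

lemma sum_circ_coeff_squares:
  assumes n: "n > 0" and k: "\<not> n dvd 2 * k"
  shows "real n - 2 \<le> (\<Sum>j=1..n div 2 + 1. (circ_coeff n k j)\<^sup>2)"
    and "(\<Sum>j=1..n div 2 + 1. (circ_coeff n k j)\<^sup>2) \<le> real n"
proof -
  let ?c = "\<lambda>d. cos (2 * pi * real d * real k / real n)"
  let ?I = "{1..n div 2 + 1}"
  let ?w = "\<lambda>j. if j = 1 \<or> 2 * (j - 1) = n then 1 else 2 :: real"
  have "(\<Sum>d<n. (?c d)\<^sup>2) = (\<Sum>d<n. 1 / 2 + cos (2 * pi * real d * of_int (int (2 * k)) / real n) / 2)"
  proof (intro sum.cong refl)
    fix d
    have "2 * pi * real d * of_int (int (2 * k)) / real n = 2 * (2 * pi * real d * real k / real n)" by simp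
    then show "(?c d)\<^sup>2 = 1 / 2 + cos (2 * pi * real d * of_int (int (2 * k)) / real n) / 2"
      by (simp only: cos_double_cos) (simp add: field_simps)
  qed
  also have "\<dots> = real n / 2"
    using sum_cos_multiples[OF n, of "int (2 * k)"] k
    by (simp only: sum.distrib sum_divide_distrib[symmetric] int_dvd_int_iff if_False) simp
  finally have half: "(\<Sum>j\<in>?I. ?w j * (?c (j - 1))\<^sup>2) = real n / 2"
    using sum_reflect_fold[OF n, of "\<lambda>d. (?c d)\<^sup>2"] cos_reflect by simp
  have "(\<Sum>j\<in>?I. (circ_coeff n k j)\<^sup>2) = (\<Sum>j\<in>?I. 2 * (?w j * (?c (j - 1))\<^sup>2)
      - (if j = 1 \<or> 2 * (j - 1) = n then (?c (j - 1))\<^sup>2 else 0))"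
    by (intro sum.cong) (auto simp: circ_coeff_def power_mult_distrib)
  also have "\<dots> = real n - (\<Sum>j\<in>?I. if j = 1 \<or> 2 * (j - 1) = n then (?c (j - 1))\<^sup>2 else 0)"
    by (simp only: sum_subtractf sum_distrib_left[symmetric] half)
  finally have eq: "(\<Sum>j\<in>?I. (circ_coeff n k j)\<^sup>2) = real n
      - (\<Sum>j\<in>?I. if j = 1 \<or> 2 * (j - 1) = n then (?c (j - 1))\<^sup>2 else 0)" .
  have "(\<Sum>j\<in>?I. if j = 1 \<or> 2 * (j - 1) = n then (?c (j - 1))\<^sup>2 else 0)
      = (\<Sum>j | j \<in> ?I \<and> (j = 1 \<or> 2 * (j - 1) = n). (?c (j - 1))\<^sup>2)"
    by (rule sum.inter_filter[symmetric]) simp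
  also have "\<dots> \<le> (\<Sum>j | j \<in> ?I \<and> (j = 1 \<or> 2 * (j - 1) = n). 1)"
    by (intro sum_mono) (simp add: abs_square_le_1)
  also have "\<dots> \<le> real (card {1, n div 2 + 1})"
    by (simp only: real_of_card[symmetric] of_nat_le_iff, rule card_mono) auto
  also have "\<dots> \<le> 2" by (simp add: card_insert_if)
  finally show "real n - 2 \<le> (\<Sum>j\<in>?I. (circ_coeff n k j)\<^sup>2)" unfolding eq by simp
  have "0 \<le> (\<Sum>j\<in>?I. if j = 1 \<or> 2 * (j - 1) = n then (?c (j - 1))\<^sup>2 else 0)"
    by (intro sum_nonneg) auto
  then show "(\<Sum>j\<in>?I. (circ_coeff n k j)\<^sup>2) \<le> real n" unfolding eq by simp
qed

lemma sum_sym_row_squares_le: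
  fixes x :: "nat \<Rightarrow> real"
  assumes n: "n > 0"
  shows "(\<Sum>d<n. (sym_row n x (d + 1))\<^sup>2) \<le> 2 * (\<Sum>j=1..n div 2 + 1. (x j)\<^sup>2)"
proof -
  have "(\<Sum>d<n. (sym_row n x (d + 1))\<^sup>2) = (\<Sum>j=1..n div 2 + 1. (if j = 1 \<or> 2 * (j - 1) = n then 1 else 2)
      * (sym_row n x (j - 1 + 1))\<^sup>2)"
    by (rule sum_reflect_fold[OF n]) (simp only: sym_row_Suc_reflect)
  also have "\<dots> \<le> (\<Sum>j=1..n div 2 + 1. 2 * (x j)\<^sup>2)"
    by (intro sum_mono) (auto simp: sym_row_def)
  finally show ?thesis by (simp add: sum_distrib_left)
qed

lemma circ_eig_convex_comb:
  "circ_eig n (\<lambda>i. (1 - t) * x i + t * y i) k = (1 - t) * circ_eig n x k + t * circ_eig n y k"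
proof -
  have "sym_row n (\<lambda>i. (1 - t) * x i + t * y i) d = (1 - t) * sym_row n x d + t * sym_row n y d" for d
    by (simp add: sym_row_def)
  then show ?thesis
    by (simp only: circ_eig_def sum_distrib_left sum.distrib[symmetric]) (simp add: algebra_simps)
qed

lemma circ_eig_diff: "circ_eig n (\<lambda>i. x i - y i) k = circ_eig n x k - circ_eig n y k"
proof -
  have "sym_row n (\<lambda>i. x i - y i) d = sym_row n x d - sym_row n y d" for d
    by (simp add: sym_row_def)
  then show ?thesis
    by (simp only: circ_eig_def sum_subtractf[symmetric] left_diff_distrib)
qed

lemma circ_eig_cong:
  assumes "n > 0" "\<And>j. j \<in> {1..n div 2 + 1} \<Longrightarrow> x j = y j"
  shows "circ_eig n x k = circ_eig n y k"
  unfolding circ_eig_coeff[OF assms(1)] using assms(2) by (intro sum.cong refl) simp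

lemma abs_circ_eig_diff_le:
  assumes "n > 0"
  shows "\<bar>circ_eig n x k - circ_eig n y k\<bar> \<le> 2 * (\<Sum>j=1..n div 2 + 1. \<bar>x j - y j\<bar>)"
proof -
  have "\<bar>circ_eig n x k - circ_eig n y k\<bar> = \<bar>\<Sum>j=1..n div 2 + 1. circ_coeff n k j * (x j - y j)\<bar>"
    by (simp only: circ_eig_coeff[OF assms] right_diff_distrib sum_subtractf)
  also have "\<dots> \<le> (\<Sum>j=1..n div 2 + 1. \<bar>circ_coeff n k j\<bar> * \<bar>x j - y j\<bar>)"
    unfolding abs_mult[symmetric] by (rule sum_abs)
  also have "\<dots> \<le> (\<Sum>j=1..n div 2 + 1. 2 * \<bar>x j - y j\<bar>)"
    by (intro sum_mono mult_right_mono abs_circ_coeff_le) simp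
  finally show ?thesis by (simp only: sum_distrib_left)
qed

lemma card_double_multiples_le:
  fixes n :: nat
  shows "card {k. k < n \<and> n dvd 2 * k} \<le> 2"
proof -
  have "{k. k < n \<and> n dvd 2 * k} \<subseteq> {0, n div 2}"
  proof
    fix k assume "k \<in> {k. k < n \<and> n dvd 2 * k}"
    then obtain r where r: "k < n" "2 * k = n * r" by (auto elim: dvdE)
    have "r < 2"
    proof (rule ccontr)
      assume "\<not> r < 2"
      then have "n * 2 \<le> n * r" by (intro mult_le_mono2) simp
      with r show False by linarith
    qed
    then have "r = 0 \<or> r = 1" by auto
    then show "k \<in> {0, n div 2}" using r by auto
  qed
  then have "card {k. k < n \<and> n dvd 2 * k} \<le> card {0, n div 2}" by (intro card_mono) auto
  also have "\<dots> \<le> 2" by (simp add: card_insert_if)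
  finally show ?thesis .
qed

section \<open>An exponential inequality for convex functions on product spaces\<close>

text \<open>
  The infimal convolution with the quadratic cost on \<open>[a, b]\<close>. The cost is normalised by the
  length of the interval, so that it is at most $1/4$ between two points of the interval.
\<close>

definition infconv :: "real \<Rightarrow> real \<Rightarrow> (real \<Rightarrow> real) \<Rightarrow> real \<Rightarrow> real" where
  "infconv a b f s = (INF y\<in>{a..b}. f y + (s - y)\<^sup>2 / (4 * (b - a)\<^sup>2))"

lemma continuous_on_add_cost:
  fixes f :: "real \<Rightarrow> real"
  assumes "continuous_on A f"
  shows "continuous_on A (\<lambda>y. f y + (s - y)\<^sup>2 / c)"
  unfolding divide_inverse by (intro continuous_intros assms)

lemma infconv_attained:
  assumes "a \<le> b" "continuous_on {a..b} f"
  obtains y where "y \<in> {a..b}" "infconv a b f s = f y + (s - y)\<^sup>2 / (4 * (b - a)\<^sup>2)"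
proof -
  let ?h = "\<lambda>y. f y + (s - y)\<^sup>2 / (4 * (b - a)\<^sup>2)"
  have "continuous_on {a..b} ?h"
    by (intro continuous_on_add_cost assms)
  then obtain y where y: "y \<in> {a..b}" "\<And>z. z \<in> {a..b} \<Longrightarrow> ?h y \<le> ?h z"
    using continuous_attains_inf[of "{a..b}" ?h] assms(1) by auto
  have "(INF y\<in>{a..b}. ?h y) = ?h y"
    using y by (intro cInf_eq_minimum) auto
  with y that show ?thesis by (auto simp: infconv_def)
qed

lemma infconv_le:
  assumes "continuous_on {a..b} f" "y \<in> {a..b}"
  shows "infconv a b f s \<le> f y + (s - y)\<^sup>2 / (4 * (b - a)\<^sup>2)"
proof -
  let ?h = "\<lambda>y. f y + (s - y)\<^sup>2 / (4 * (b - a)\<^sup>2)"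
  have "continuous_on {a..b} ?h"
    by (intro continuous_on_add_cost assms)
  then have "bdd_below (?h ` {a..b})"
    by (intro bounded_imp_bdd_below compact_imp_bounded compact_continuous_image) auto
  then show ?thesis
    unfolding infconv_def using assms(2) by (intro cINF_lower)
qed

text \<open>
  Restricting the infimum to a countable dense set makes the infimal convolution measurable in parameters.
\<close>

lemma infconv_eq_dense:
  assumes "continuous_on {a..b} f" "D \<subseteq> {a..b}" "{a..b} \<subseteq> closure D" "a \<le> b"
  shows "infconv a b f s = (INF y\<in>D. f y + (s - y)\<^sup>2 / (4 * (b - a)\<^sup>2))"
    and "bdd_below ((\<lambda>y. f y + (s - y)\<^sup>2 / (4 * (b - a)\<^sup>2)) ` D)"
proof -
  let ?h = "\<lambda>y. f y + (s - y)\<^sup>2 / (4 * (b - a)\<^sup>2)"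
  have cl: "closure D = {a..b}"
    using assms(2,3) by (metis closed_real_atLeastAtMost closure_minimal subset_antisym)
  have ne: "D \<noteq> {}" using cl assms(4) by auto
  show bdd: "bdd_below (?h ` D)"
    using infconv_le[OF assms(1)] assms(2) by (auto intro!: bdd_belowI[of _ "infconv a b f s"])
  have "continuous_on (closure D) ?h"
    unfolding cl by (intro continuous_on_add_cost assms)
  then have "(INF y\<in>D. ?h y) \<le> ?h z" if "z \<in> {a..b}" for z
  proof (rule continuous_ge_on_closure)
    show "z \<in> closure D" using that by (simp add: cl)
    show "(INF y\<in>D. ?h y) \<le> ?h x" if "x \<in> D" for x
      by (rule cINF_lower[OF bdd that])
  qed
  then have "(INF y\<in>D. ?h y) \<le> infconv a b f s"
    unfolding infconv_def using assms(4) by (intro cINF_greatest) auto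
  moreover have "infconv a b f s \<le> (INF y\<in>D. ?h y)"
    using ne infconv_le[OF assms(1)] assms(2) by (intro cINF_greatest) auto
  ultimately show "infconv a b f s = (INF y\<in>D. ?h y)" by simp
qed

text \<open>
  The left side minus the right side vanishes at $0$ and decreases, because
  $1 - 2u \le \exp (u^2 - 2u)$.
\<close>

lemma exp_quadratic_bound:
  assumes "0 \<le> u" "u \<le> (1/2 :: real)"
  shows "exp (u - u\<^sup>2) \<le> 2 - exp (- u)"
proof -
  let ?h = "\<lambda>u::real. exp (u - u\<^sup>2) + exp (- u)"
  have "?h u \<le> ?h 0"
  proof (rule DERIV_nonpos_imp_nonincreasing[OF assms(1)])
    fix x :: real assume x: "0 \<le> x" "x \<le> u"
    have "(?h has_real_derivative ((1 - 2 * x) * exp (x - x\<^sup>2) - exp (- x))) (at x)"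
      by (auto intro!: derivative_eq_intros simp: algebra_simps)
    moreover have "(1 - 2 * x) * exp (x - x\<^sup>2) - exp (- x) \<le> 0"
    proof -
      have "1 - 2 * x \<le> 1 + (x\<^sup>2 - 2 * x)" by simp
      also have "\<dots> \<le> exp (x\<^sup>2 - 2 * x)" by (rule exp_ge_add_one_self)
      finally have "(1 - 2 * x) * exp (x - x\<^sup>2) \<le> exp (x\<^sup>2 - 2 * x) * exp (x - x\<^sup>2)"
        by (intro mult_right_mono) auto
      also have "\<dots> = exp (- x)" by (simp add: exp_add[symmetric])
      finally show ?thesis by simp
    qed
    ultimately show "\<exists>y. (?h has_real_derivative y) (at x) \<and> y \<le> 0" by blast
  qed
  then show ?thesis by simp
qed

text \<open>
  Moving from \<open>s\<close> by the fraction $\theta$ of the way towards \<open>z\<close> costs at most $\theta^2/4$, and by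
  convexity it lowers \<open>f\<close> by at least $\theta u$, where $u = f(s) - f(z)$. The choice $\theta = \min (2u, 1)$
  leaves an excess over $f(z)$ of $u - u^2$ for $u \le 1/2$ and of $1/4$ otherwise; in both cases the
  exponential of the excess is at most $2 - e^{-u}$.
\<close>

lemma infconv_exp_le:
  assumes ab: "a < b" and f: "convex_on UNIV f" and s: "s \<in> {a..b}" and z: "z \<in> {a..b}" "f z \<le> f s"
  shows "exp (infconv a b f s) \<le> exp (f z) * (2 - exp (- (f s - f z)))"
proof -
  have cont: "continuous_on {a..b} f"
    using convex_on_continuous[OF open_UNIV f] by (rule continuous_on_subset) simp
  define u where "u = f s - f z"
  have u: "0 \<le> u" using z by (simp add: u_def)
  have step: "infconv a b f s \<le> f z + ((1 - \<theta>) * u + \<theta>\<^sup>2 / 4)" if \<theta>: "0 \<le> \<theta>" "\<theta> \<le> 1" for \<theta>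
  proof -
    define y where "y = (1 - \<theta>) * s + \<theta> * z"
    have y: "y \<in> {a..b}"
      using convexD_alt[OF convex_real_interval(5)[of a b] s z(1) \<theta>] by (simp add: y_def)
    have "s - y = \<theta> * (s - z)" by (simp add: y_def algebra_simps)
    then have "(s - y)\<^sup>2 = \<theta>\<^sup>2 * (s - z)\<^sup>2" by (simp add: power_mult_distrib)
    also have "\<dots> \<le> \<theta>\<^sup>2 * (b - a)\<^sup>2"
      using s z ab by (intro mult_left_mono) (auto simp: abs_le_square_iff[symmetric])
    finally have "(s - y)\<^sup>2 / (4 * (b - a)\<^sup>2) \<le> \<theta>\<^sup>2 / 4"
      using ab by (simp add: field_simps)
    moreover have "f y \<le> (1 - \<theta>) * f s + \<theta> * f z"
      using convex_onD[OF f \<theta>, of s z] by (simp add: y_def)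
    ultimately show ?thesis
      using infconv_le[OF cont y, of s] by (simp add: u_def algebra_simps)
  qed
  have "exp (infconv a b f s) \<le> exp (f z) * (2 - exp (- u))"
  proof (cases "u \<le> 1/2")
    case True
    have "infconv a b f s \<le> f z + ((1 - 2 * u) * u + (2 * u)\<^sup>2 / 4)"
      using u True by (intro step) auto
    also have "(1 - 2 * u) * u + (2 * u)\<^sup>2 / 4 = u - u\<^sup>2"
      by (simp add: power2_eq_square algebra_simps)
    finally have "exp (infconv a b f s) \<le> exp (f z) * exp (u - u\<^sup>2)"
      by (simp add: exp_add[symmetric])
    also have "\<dots> \<le> exp (f z) * (2 - exp (- u))"
      using exp_quadratic_bound[OF u True] by (intro mult_left_mono) auto
    finally show ?thesis .
  next
    case False
    have "exp (1/4 :: real) \<le> 2 - exp (- (1/2))"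
      using exp_quadratic_bound[of "1/2"] by (simp add: power2_eq_square)
    also have "\<dots> \<le> 2 - exp (- u)" using False by simp
    finally have *: "exp (1/4 :: real) \<le> 2 - exp (- u)" .
    have "infconv a b f s \<le> f z + 1/4" using step[of 1] by simp
    then have "exp (infconv a b f s) \<le> exp (f z) * exp (1/4)"
      by (simp add: exp_add[symmetric])
    also have "\<dots> \<le> exp (f z) * (2 - exp (- u))"
      using * by (intro mult_left_mono) auto
    finally show ?thesis .
  qed
  then show ?thesis by (simp add: u_def)
qed

text \<open>
  Let \<open>z\<close> minimise \<open>f\<close> on the interval and let \<open>w\<close> be the integral of $e^{-(f - f(z))}$. The pointwise
  bound of \<open>infconv_exp_le\<close> integrates to $e^{f(z)}(2 - w)$, and $(2 - w)\,w \le 1$.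
\<close>

lemma maurey_one_dim:
  assumes ab: "a < b" and f: "convex_on UNIV f"
    and "prob_space \<nu>" and [measurable_cong]: "sets \<nu> = sets borel" and supp: "AE s in \<nu>. s \<in> {a..b}"
  shows "(\<integral>\<^sup>+s. ennreal (exp (infconv a b f s)) \<partial>\<nu>) * (\<integral>\<^sup>+s. ennreal (exp (- f s)) \<partial>\<nu>) \<le> 1"
proof -
  interpret prob_space \<nu> by fact
  have cont: "continuous_on UNIV f" by (rule convex_on_continuous[OF open_UNIV f])
  then have [measurable]: "f \<in> borel_measurable borel" by (rule borel_measurable_continuous_onI)
  obtain z where z: "z \<in> {a..b}" "\<And>s. s \<in> {a..b} \<Longrightarrow> f z \<le> f s"
    using continuous_attains_inf[of "{a..b}" f] ab continuous_on_subset[OF cont] by auto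
  define r where "r s = exp (- (f s - f z))" for s
  have [measurable]: "r \<in> borel_measurable borel" unfolding r_def by measurable
  have r: "AE s in \<nu>. 0 \<le> r s \<and> r s \<le> 1"
    using supp by eventually_elim (use z in \<open>auto simp: r_def\<close>)
  have int: "integrable \<nu> r"
    using r by (intro integrable_const_bound[where B=1]) (auto elim: eventually_mono)
  define w where "w = (\<integral>s. r s \<partial>\<nu>)"
  have "0 \<le> w"
    unfolding w_def using r by (intro integral_nonneg_AE) (auto elim: eventually_mono)
  moreover have "w \<le> 1"
    unfolding w_def using r by (intro integral_le_const int) (auto elim: eventually_mono)
  ultimately have w: "0 \<le> w" "w \<le> 1" by simp_all
  have "(\<integral>\<^sup>+s. ennreal (exp (infconv a b f s)) \<partial>\<nu>) \<le> (\<integral>\<^sup>+s. ennreal (exp (f z) * (2 - r s)) \<partial>\<nu>)"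
  proof (rule nn_integral_mono_AE)
    show "AE s in \<nu>. ennreal (exp (infconv a b f s)) \<le> ennreal (exp (f z) * (2 - r s))"
      using supp
    proof eventually_elim
      case (elim s)
      show ?case
        unfolding r_def using infconv_exp_le[OF ab f elim z(1) z(2)[OF elim]] by (rule ennreal_leI)
    qed
  qed
  also have "\<dots> = ennreal (\<integral>s. exp (f z) * (2 - r s) \<partial>\<nu>)"
  proof (rule nn_integral_eq_integral)
    show "integrable \<nu> (\<lambda>s. exp (f z) * (2 - r s))" by (auto intro: int)
    show "AE s in \<nu>. 0 \<le> exp (f z) * (2 - r s)" using r by eventually_elim auto
  qed
  also have "(\<integral>s. exp (f z) * (2 - r s) \<partial>\<nu>) = exp (f z) * (2 - w)"
    using int by (simp add: w_def prob_space)
  finally have 1: "(\<integral>\<^sup>+s. ennreal (exp (infconv a b f s)) \<partial>\<nu>) \<le> ennreal (exp (f z) * (2 - w))" .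
  have "(\<integral>\<^sup>+s. ennreal (exp (- f s)) \<partial>\<nu>) = (\<integral>\<^sup>+s. ennreal (exp (- f z) * r s) \<partial>\<nu>)"
    by (simp add: r_def exp_add[symmetric])
  also have "\<dots> = ennreal (\<integral>s. exp (- f z) * r s \<partial>\<nu>)"
    by (intro nn_integral_eq_integral integrable_mult_right int) (simp add: r_def)
  also have "\<dots> = ennreal (exp (- f z) * w)" by (simp add: w_def)
  finally have 2: "(\<integral>\<^sup>+s. ennreal (exp (- f s)) \<partial>\<nu>) = ennreal (exp (- f z) * w)" .
  have "(\<integral>\<^sup>+s. ennreal (exp (infconv a b f s)) \<partial>\<nu>) * (\<integral>\<^sup>+s. ennreal (exp (- f s)) \<partial>\<nu>)
      \<le> ennreal (exp (f z) * (2 - w)) * ennreal (exp (- f z) * w)"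
    unfolding 2 by (intro mult_right_mono 1) auto
  also have "\<dots> = ennreal ((2 - w) * w)"
    using w by (simp add: ennreal_mult[symmetric] exp_minus)
  also have "(2 - w) * w \<le> 1"
    using zero_le_power2[of "1 - w"] by (simp add: power2_eq_square algebra_simps)
  finally show ?thesis by (simp add: ennreal_leI)
qed

text \<open>
  Convexity of a functional of a family of reals, with convex combinations formed coordinatewise,
  so that the index type stays arbitrary while the set of active coordinates varies in the induction below.
\<close>

definition fun_convex :: "(('i \<Rightarrow> real) \<Rightarrow> real) \<Rightarrow> bool" where
  "fun_convex F \<longleftrightarrow> (\<forall>t x y. 0 \<le> t \<longrightarrow> t \<le> 1 \<longrightarrow>
     F (\<lambda>i. (1 - t) * x i + t * y i) \<le> (1 - t) * F x + t * F y)"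

lemma fun_convexD:
  "fun_convex F \<Longrightarrow> 0 \<le> t \<Longrightarrow> t \<le> 1 \<Longrightarrow> F (\<lambda>i. (1 - t) * x i + t * y i) \<le> (1 - t) * F x + t * F y"
  by (auto simp: fun_convex_def)

lemma fun_convex_upd:
  assumes "fun_convex F"
  shows "convex_on UNIV (\<lambda>s. F (x(i := s)))"
proof (rule convex_onI)
  fix t s s' :: real assume t: "0 < t" "t < 1"
  have "x(i := (1 - t) * s + t * s') = (\<lambda>j. (1 - t) * (x(i := s)) j + t * (x(i := s')) j)"
    by (auto simp: fun_eq_iff algebra_simps)
  then show "F (x(i := (1 - t) *\<^sub>R s + t *\<^sub>R s')) \<le> (1 - t) * F (x(i := s)) + t * F (x(i := s'))"
    using fun_convexD[OF assms, of t "x(i := s)" "x(i := s')"] t by simp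
qed auto

text \<open>
  Hoelder's inequality in the form needed to show that $x \mapsto \ln\int e^{g(x,s)}\,ds$ is convex if \<open>g\<close>
  is jointly convex. Dividing by the normalising integrals reduces it to convexity of the exponential.
\<close>

lemma ln_integral_exp_convex:
  fixes g h k :: "'a \<Rightarrow> real"
  assumes g: "integrable M (\<lambda>s. exp (g s))" and h: "integrable M (\<lambda>s. exp (h s))"
    and k: "integrable M (\<lambda>s. exp (k s))"
    and pos: "0 < (\<integral>s. exp (g s) \<partial>M)" "0 < (\<integral>s. exp (h s) \<partial>M)" "0 < (\<integral>s. exp (k s) \<partial>M)"
    and t: "0 \<le> t" "t \<le> 1" and le: "\<And>s. k s \<le> (1 - t) * g s + t * h s"
  shows "ln (\<integral>s. exp (k s) \<partial>M) \<le> (1 - t) * ln (\<integral>s. exp (g s) \<partial>M) + t * ln (\<integral>s. exp (h s) \<partial>M)"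
proof -
  define A where "A = (\<integral>s. exp (g s) \<partial>M)"
  define B where "B = (\<integral>s. exp (h s) \<partial>M)"
  have AB: "A > 0" "B > 0" using pos by (simp_all add: A_def B_def)
  let ?c = "exp ((1 - t) * ln A + t * ln B)"
  have "exp (k s) \<le> ?c * ((1 - t) * (exp (g s) / A) + t * (exp (h s) / B))" for s
  proof -
    have "exp (k s) \<le> exp ((1 - t) * g s + t * h s)" using le by simp
    also have "\<dots> = ?c * exp ((1 - t) * (g s - ln A) + t * (h s - ln B))"
      by (simp add: exp_add[symmetric] algebra_simps)
    also have "exp ((1 - t) * (g s - ln A) + t * (h s - ln B))
        \<le> (1 - t) * exp (g s - ln A) + t * exp (h s - ln B)"
      using convex_onD[OF exp_convex t, of "g s - ln A" "h s - ln B"] by simp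
    finally show ?thesis using AB by (simp add: exp_diff)
  qed
  then have "(\<integral>s. exp (k s) \<partial>M) \<le> (\<integral>s. ?c * ((1 - t) * (exp (g s) / A) + t * (exp (h s) / B)) \<partial>M)"
    using g h k by (intro integral_mono) auto
  also have "\<dots> = ?c * ((1 - t) * (A / A) + t * (B / B))"
    using g h by (simp add: A_def B_def)
  also have "\<dots> = ?c" using AB by simp
  finally have "ln (\<integral>s. exp (k s) \<partial>M) \<le> ln ?c"
    using pos by (subst ln_le_cancel_iff) auto
  then show ?thesis by (simp add: A_def B_def)
qed

text \<open>
  Maurey's inequality. The upper bound for \<open>G\<close> says that \<open>G\<close> lies below the exponential of the
  infimal convolution of \<open>f\<close> with the quadratic cost in all coordinates. Coordinates are integrated
  out one at a time. Integrating the coordinate \<open>i\<close> replaces \<open>f\<close> by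
  $f_1(x) = \ln\int\exp (Q_i f)$, where $Q_i$ is the infimal convolution in that coordinate only. This
  $f_1$ is convex again, since $Q_i f$ is jointly convex in all coordinates; it has the right relation
  to the integral of \<open>G\<close>; and the one-dimensional inequality bounds the integral of $e^{-f}$ over that
  coordinate by $e^{-f_1}$. Working with $-\ln\int e^{-f}$ instead of $f_1$ would lose convexity.
\<close>

lemma maurey_product:
  fixes \<nu> :: "'i \<Rightarrow> real measure" and f :: "('i \<Rightarrow> real) \<Rightarrow> real" and G :: "('i \<Rightarrow> real) \<Rightarrow> ennreal"
  assumes ab: "a < b" and "finite I"
    and prob: "\<And>i. prob_space (\<nu> i)" and sets: "\<And>i. sets (\<nu> i) = sets borel"
    and supp: "\<And>i. i \<in> I \<Longrightarrow> AE s in \<nu> i. s \<in> {a..b}"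
    and f: "fun_convex f" "f \<in> borel_measurable (PiM I \<nu>)" and G: "G \<in> borel_measurable (PiM I \<nu>)"
    and le: "\<And>x y. (\<And>i. i \<in> I \<Longrightarrow> y i \<in> {a..b}) \<Longrightarrow>
       G x \<le> ennreal (exp (f y + (\<Sum>i\<in>I. (x i - y i)\<^sup>2) / (4 * (b - a)\<^sup>2)))"
  shows "(\<integral>\<^sup>+x. G x \<partial>PiM I \<nu>) * (\<integral>\<^sup>+x. ennreal (exp (- f x)) \<partial>PiM I \<nu>) \<le> 1"
  using \<open>finite I\<close> supp f G le
proof (induction I arbitrary: f G rule: finite_induct)
  case empty
  interpret product_sigma_finite \<nu>
    using prob by (simp add: product_sigma_finite_def prob_space_imp_sigma_finite)
  let ?u = "\<lambda>_::'i. undefined :: real"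
  have "G ?u * ennreal (exp (- f ?u)) \<le> ennreal (exp (f ?u)) * ennreal (exp (- f ?u))"
    using empty.prems(5)[of ?u ?u] by (intro mult_right_mono) auto
  also have "\<dots> = 1"
    by (simp add: ennreal_mult[symmetric] exp_minus)
  finally show ?case by (simp add: PiM_empty nn_integral_count_space_finite)
next
  case (insert i I)
  interpret product_sigma_finite \<nu>
    using prob by (simp add: product_sigma_finite_def prob_space_imp_sigma_finite)
  interpret \<nu>i: prob_space "\<nu> i" by (rule prob)
  have sf: "sigma_finite_measure (\<nu> i)" by (rule prob_space_imp_sigma_finite[OF prob])
  note [measurable_cong] = sets
  note fm = insert.prems(3) and Gm = insert.prems(4)
  define K where "K = 4 * (b - a)\<^sup>2"
  have K: "K > 0" using ab by (simp add: K_def)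
  define q where "q x = infconv a b (\<lambda>y. f (x(i := y)))" for x
  define e where "e x = (\<integral>s. exp (q x s) \<partial>\<nu> i)" for x
  define f1 where "f1 x = ln (e x)" for x
  define G1 where "G1 x = (\<integral>\<^sup>+s. G (x(i := s)) \<partial>\<nu> i)" for x
  have conv: "convex_on UNIV (\<lambda>y. f (x(i := y)))" for x
    by (rule fun_convex_upd[OF insert.prems(2)])
  have cont: "continuous_on A (\<lambda>y. f (x(i := y)))" for x A
    using convex_on_continuous[OF open_UNIV conv] by (rule continuous_on_subset) simp
  have attain: "\<exists>y\<in>{a..b}. q x s = f (x(i := y)) + (s - y)\<^sup>2 / K" for x s
    using infconv_attained[OF less_imp_le[OF ab] cont, of x s] unfolding q_def K_def by blast
  have q_le: "q x s \<le> f (x(i := y)) + (s - y)\<^sup>2 / K" if "y \<in> {a..b}" for x s y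
    using infconv_le[OF cont that] by (simp add: q_def K_def)
  obtain D where D: "countable D" "D \<subseteq> {a..b}" "{a..b} \<subseteq> closure D"
    using separable[of "{a..b}"] by blast
  have q_dense: "q x s = (INF y\<in>D. f (x(i := y)) + (s - y)\<^sup>2 / K)"
    "bdd_below ((\<lambda>y. f (x(i := y)) + (s - y)\<^sup>2 / K) ` D)" for x s
    using infconv_eq_dense[OF cont D(2,3) less_imp_le[OF ab], of x s] by (simp_all add: q_def K_def)
  have upd: "(\<lambda>x. x(i := y)) \<in> measurable (PiM I \<nu>) (PiM (insert i I) \<nu>)" for y
  proof -
    have "(\<lambda>x. (x, y)) \<in> measurable (PiM I \<nu>) (PiM I \<nu> \<Otimes>\<^sub>M \<nu> i)"
      using sets_eq_imp_space_eq[OF sets[of i]] by (intro measurable_Pair) auto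
    from measurable_compose[OF this measurable_add_dim] show ?thesis by simp
  qed
  have q_meas: "(\<lambda>(x, s). q x s) \<in> borel_measurable (PiM I \<nu> \<Otimes>\<^sub>M \<nu> i)"
  proof -
    have [measurable]: "(\<lambda>x. f (x(i := y))) \<in> borel_measurable (PiM I \<nu>)" for y
      by (rule measurable_compose[OF upd fm])
    show ?thesis
      unfolding q_dense(1) case_prod_beta
      by (intro borel_measurable_cINF D(1) q_dense(2)) measurable
  qed
  have q_meas1: "q x \<in> borel_measurable (\<nu> i)" for x
  proof -
    have "(\<lambda>s. INF y\<in>D. f (x(i := y)) + (s - y)\<^sup>2 / K) \<in> borel_measurable (\<nu> i)"
      by (intro borel_measurable_cINF D(1) q_dense(2)) measurable
    then show ?thesis by (simp add: q_dense(1)[symmetric])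
  qed
  have G1_meas: "G1 \<in> borel_measurable (PiM I \<nu>)"
    unfolding G1_def using measurable_compose[OF measurable_add_dim Gm]
    by (intro sigma_finite_measure.borel_measurable_nn_integral sf) (simp add: case_prod_unfold fun_upd_def)
  have f1_meas: "f1 \<in> borel_measurable (PiM I \<nu>)"
    unfolding f1_def e_def using measurable_compose[OF q_meas borel_measurable_exp]
    by (intro borel_measurable_ln sigma_finite_measure.borel_measurable_lebesgue_integral sf) (simp add: case_prod_unfold)
  have e_int: "integrable (\<nu> i) (\<lambda>s. exp (q x s))" for x
  proof (rule \<nu>i.integrable_const_bound)
    show "AE s in \<nu> i. norm (exp (q x s)) \<le> exp (f (x(i := a)) + (b - a)\<^sup>2 / K)"
      using insert.prems(1)[OF insertI1]
    proof eventually_elim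
      case (elim s)
      have "(s - a)\<^sup>2 / K \<le> (b - a)\<^sup>2 / K"
        using elim K by (intro divide_right_mono power_mono) auto
      then show ?case using q_le[of a x s] ab by simp
    qed
    show "(\<lambda>s. exp (q x s)) \<in> borel_measurable (\<nu> i)"
      using q_meas1 by measurable
  qed
  have e_pos: "e x > 0" for x
    unfolding e_def by (intro \<nu>i.expectation_greater e_int) auto
  have nn_e: "(\<integral>\<^sup>+s. ennreal (exp (q x s)) \<partial>\<nu> i) = ennreal (e x)" for x
    unfolding e_def by (intro nn_integral_eq_integral e_int) auto
  have f1_conv: "fun_convex f1"
    unfolding fun_convex_def
  proof (intro allI impI)
    fix t :: real and x y :: "'i \<Rightarrow> real" assume t: "0 \<le> t" "t \<le> 1"
    let ?z = "\<lambda>i. (1 - t) * x i + t * y i"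
    have "q ?z s \<le> (1 - t) * q x s + t * q y s" for s
    proof -
      obtain u v where u: "u \<in> {a..b}" "q x s = f (x(i := u)) + (s - u)\<^sup>2 / K"
        and v: "v \<in> {a..b}" "q y s = f (y(i := v)) + (s - v)\<^sup>2 / K"
        using attain[of x s] attain[of y s] by blast
      let ?w = "(1 - t) * u + t * v"
      have w: "?w \<in> {a..b}"
        using convexD_alt[OF convex_real_interval(5)[of a b] u(1) v(1) t] by simp
      have "?z(i := ?w) = (\<lambda>j. (1 - t) * (x(i := u)) j + t * (y(i := v)) j)"
        by (auto simp: fun_eq_iff)
      then have 1: "f (?z(i := ?w)) \<le> (1 - t) * f (x(i := u)) + t * f (y(i := v))"
        using fun_convexD[OF insert.prems(2) t, of "x(i := u)" "y(i := v)"] by (simp only:)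
      have "(s - ?w)\<^sup>2 = ((1 - t) * (s - u) + t * (s - v))\<^sup>2"
        by (simp add: algebra_simps)
      also have "\<dots> \<le> (1 - t) * (s - u)\<^sup>2 + t * (s - v)\<^sup>2"
        using convex_onD[OF convex_power2 t, of "s - u" "s - v"] by simp
      finally have "(s - ?w)\<^sup>2 / K \<le> ((1 - t) * (s - u)\<^sup>2 + t * (s - v)\<^sup>2) / K"
        using K by (intro divide_right_mono) auto
      then have 2: "(s - ?w)\<^sup>2 / K \<le> (1 - t) * ((s - u)\<^sup>2 / K) + t * ((s - v)\<^sup>2 / K)"
        by (simp add: add_divide_distrib)
      show ?thesis
        using q_le[OF w, of ?z s] 1 2 unfolding u(2) v(2) distrib_left by linarith
    qed
    then show "f1 ?z \<le> (1 - t) * f1 x + t * f1 y"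
      using e_int e_pos t unfolding f1_def e_def by (intro ln_integral_exp_convex) auto
  qed
  have G1_le: "G1 x \<le> ennreal (exp (f1 y + (\<Sum>j\<in>I. (x j - y j)\<^sup>2) / K))"
    if y: "\<And>j. j \<in> I \<Longrightarrow> y j \<in> {a..b}" for x y
  proof -
    define S where "S = (\<Sum>j\<in>I. (x j - y j)\<^sup>2) / K"
    have "G (x(i := s)) \<le> ennreal (exp S) * ennreal (exp (q y s))" for s
    proof -
      obtain u where u: "u \<in> {a..b}" "q y s = f (y(i := u)) + (s - u)\<^sup>2 / K"
        using attain by blast
      have "(\<Sum>j\<in>insert i I. ((x(i := s)) j - (y(i := u)) j)\<^sup>2) = (s - u)\<^sup>2 + (\<Sum>j\<in>I. (x j - y j)\<^sup>2)"
        using insert.hyps by (auto intro!: sum.cong)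
      moreover have "(y(i := u)) j \<in> {a..b}" if "j \<in> insert i I" for j
        using that u(1) y by auto
      ultimately have "G (x(i := s)) \<le> ennreal (exp (f (y(i := u)) + ((s - u)\<^sup>2 + (\<Sum>j\<in>I. (x j - y j)\<^sup>2)) / K))"
        using insert.prems(5)[of "y(i := u)" "x(i := s)"] by (simp only: K_def)
      also have "f (y(i := u)) + ((s - u)\<^sup>2 + (\<Sum>j\<in>I. (x j - y j)\<^sup>2)) / K = S + q y s"
        by (simp add: u S_def add_divide_distrib)
      finally show ?thesis
        by (simp only: exp_add ennreal_mult[OF exp_ge_zero exp_ge_zero])
    qed
    then have "G1 x \<le> (\<integral>\<^sup>+s. ennreal (exp S) * ennreal (exp (q y s)) \<partial>\<nu> i)"
      unfolding G1_def by (intro nn_integral_mono)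
    also have "\<dots> = ennreal (exp S) * ennreal (e y)"
      using q_meas1[of y] by (subst nn_integral_cmult) (auto simp: nn_e)
    also have "\<dots> = ennreal (exp (f1 y + S))"
      using e_pos[of y] by (simp add: f1_def exp_add ennreal_mult mult.commute)
    finally show ?thesis by (simp add: S_def)
  qed
  have IH: "(\<integral>\<^sup>+x. G1 x \<partial>PiM I \<nu>) * (\<integral>\<^sup>+x. ennreal (exp (- f1 x)) \<partial>PiM I \<nu>) \<le> 1"
    using insert.prems(1) f1_conv f1_meas G1_meas G1_le unfolding K_def by (intro insert.IH) auto
  have "(\<integral>\<^sup>+x. ennreal (exp (- f x)) \<partial>PiM (insert i I) \<nu>)
      = (\<integral>\<^sup>+x. \<integral>\<^sup>+s. ennreal (exp (- f (x(i := s)))) \<partial>\<nu> i \<partial>PiM I \<nu>)"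
    using insert.hyps fm by (intro product_nn_integral_insert) auto
  also have "\<dots> \<le> (\<integral>\<^sup>+x. ennreal (exp (- f1 x)) \<partial>PiM I \<nu>)"
  proof (intro nn_integral_mono)
    fix x
    let ?J = "\<integral>\<^sup>+s. ennreal (exp (- f (x(i := s)))) \<partial>\<nu> i"
    have "ennreal (e x) * ?J \<le> 1"
      using maurey_one_dim[OF ab conv prob sets insert.prems(1)[OF insertI1], of x]
      by (simp add: nn_e[symmetric] q_def)
    then have "ennreal (exp (- f1 x)) * (ennreal (e x) * ?J) \<le> ennreal (exp (- f1 x)) * 1"
      by (intro mult_left_mono) auto
    also have "ennreal (exp (- f1 x)) * (ennreal (e x) * ?J) = ?J"
      using e_pos[of x] by (simp add: mult.assoc[symmetric] ennreal_mult[symmetric] f1_def exp_minus)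
    finally show "?J \<le> ennreal (exp (- f1 x))" by simp
  qed
  finally have 2: "(\<integral>\<^sup>+x. ennreal (exp (- f x)) \<partial>PiM (insert i I) \<nu>)
     \<le> (\<integral>\<^sup>+x. ennreal (exp (- f1 x)) \<partial>PiM I \<nu>)" .
  have 1: "(\<integral>\<^sup>+x. G x \<partial>PiM (insert i I) \<nu>) = (\<integral>\<^sup>+x. G1 x \<partial>PiM I \<nu>)"
    unfolding G1_def using insert.hyps Gm by (intro product_nn_integral_insert) auto
  show ?case
    unfolding 1 using mult_left_mono[OF 2, of "\<integral>\<^sup>+x. G1 x \<partial>PiM I \<nu>"] IH by (auto intro: order_trans)
qed

section \<open>Concentration of convex functions of independent bounded variables\<close>

context prob_space
begin

text \<open>
  A Lipschitz bound with constant \<open>L\<close> puts the function $lF - (lL(b - a))^2$ below the infimal convolution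
  of $lF$, by $lLr \le (lL(b-a))^2 + r^2/(4(b-a)^2)$.
\<close>

lemma maurey_indep_vars:
  fixes Y :: "'i \<Rightarrow> 'a \<Rightarrow> real" and F :: "('i \<Rightarrow> real) \<Rightarrow> real"
  assumes ab: "a < b" and I: "finite I" "I \<noteq> {}" and indep: "indep_vars (\<lambda>_. borel) Y I"
    and Y: "\<And>i \<omega>. i \<in> I \<Longrightarrow> \<omega> \<in> space M \<Longrightarrow> Y i \<omega> \<in> {a..b}"
    and conv: "fun_convex F" and meas: "F \<in> borel_measurable (PiM I (\<lambda>_. borel))"
    and lip: "\<And>x y. F x - F y \<le> L * sqrt (\<Sum>i\<in>I. (x i - y i)\<^sup>2)" and l: "0 \<le> l"
  shows "(\<integral>\<^sup>+\<omega>. ennreal (exp (l * F (\<lambda>i\<in>I. Y i \<omega>))) \<partial>M) *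
      (\<integral>\<^sup>+\<omega>. ennreal (exp (- (l * F (\<lambda>i\<in>I. Y i \<omega>)))) \<partial>M)
      \<le> ennreal (exp ((l * L * (b - a))\<^sup>2))"
proof -
  define \<nu> where "\<nu> i = distr M borel (if i \<in> I then Y i else (\<lambda>_. a))" for i
  have rv: "random_variable borel (Y i)" if "i \<in> I" for i
    using indep that by (auto simp: indep_vars_def2)
  have rv': "random_variable borel (if i \<in> I then Y i else (\<lambda>_. a))" for i
    using rv by auto
  have sets_\<nu>: "sets (\<nu> i) = sets borel" for i by (simp add: \<nu>_def)
  have sets_PiM: "sets (PiM I \<nu>) = sets (PiM I (\<lambda>_. borel))"
    by (rule sets_PiM_cong) (simp_all add: sets_\<nu>)
  have Fm: "F \<in> borel_measurable (PiM I \<nu>)"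
    using meas by (simp cong: measurable_cong_sets add: sets_PiM)
  let ?Y = "\<lambda>\<omega>. \<lambda>i\<in>I. Y i \<omega>"
  have distr: "distr M (PiM I (\<lambda>_. borel)) ?Y = PiM I \<nu>"
  proof -
    have "distr M (PiM I (\<lambda>_. borel)) ?Y = PiM I (\<lambda>i. distr M borel (Y i))"
      using indep_vars_iff_distr_eq_PiM'[OF I(2), where M' = "\<lambda>_. borel" and X = Y] rv indep by simp
    also have "\<dots> = PiM I \<nu>" by (rule PiM_cong) (auto simp: \<nu>_def)
    finally show ?thesis .
  qed
  have Ym: "?Y \<in> measurable M (PiM I (\<lambda>_. borel))"
    using rv by (intro measurable_restrict) auto
  have tr: "(\<integral>\<^sup>+\<omega>. g (?Y \<omega>) \<partial>M) = (\<integral>\<^sup>+x. g x \<partial>PiM I \<nu>)"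
    if "g \<in> borel_measurable (PiM I (\<lambda>_. borel))" for g
    using that Ym by (simp add: distr[symmetric] nn_integral_distr)
  define D where "D = b - a"
  have D: "D > 0" using ab by (simp add: D_def)
  define c where "c = exp ((l * L * D)\<^sup>2)"
  have "(\<integral>\<^sup>+x. ennreal (exp (l * F x) / c) \<partial>PiM I \<nu>) * (\<integral>\<^sup>+x. ennreal (exp (- (l * F x))) \<partial>PiM I \<nu>) \<le> 1"
  proof (rule maurey_product[OF ab I(1)])
    show "prob_space (\<nu> i)" for i
      unfolding \<nu>_def by (rule prob_space_distr[OF rv'])
    show "AE s in \<nu> i. s \<in> {a..b}" if "i \<in> I" for i
    proof -
      have "AE s in distr M borel (Y i). s \<in> {a..b}"
        using rv[OF that] Y[OF that] by (subst AE_distr_iff) auto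
      moreover have "\<nu> i = distr M borel (Y i)" using that by (simp add: \<nu>_def)
      ultimately show ?thesis by (simp only:)
    qed
    show "fun_convex (\<lambda>x. l * F x)"
      unfolding fun_convex_def
    proof (intro allI impI)
      fix t :: real and x y :: "'i \<Rightarrow> real" assume "0 \<le> t" "t \<le> 1"
      from mult_left_mono[OF fun_convexD[OF conv this, of x y] l]
      show "l * F (\<lambda>i. (1 - t) * x i + t * y i) \<le> (1 - t) * (l * F x) + t * (l * F y)"
        by (simp add: algebra_simps)
    qed
    show "(\<lambda>x. l * F x) \<in> borel_measurable (PiM I \<nu>)" using Fm by measurable
    show "(\<lambda>x. ennreal (exp (l * F x) / c)) \<in> borel_measurable (PiM I \<nu>)" using Fm by measurable
    fix x y :: "'i \<Rightarrow> real"
    define S where "S = (\<Sum>i\<in>I. (x i - y i)\<^sup>2)"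
    have S: "0 \<le> S" by (auto simp: S_def intro: sum_nonneg)
    have "l * F x - l * F y \<le> l * L * sqrt S"
      using mult_left_mono[OF lip[of x y] l] by (simp add: S_def right_diff_distrib mult.assoc)
    also have "\<dots> \<le> (l * L * D)\<^sup>2 + S / (4 * D\<^sup>2)"
    proof -
      have "0 \<le> (l * L * D - sqrt S / (2 * D))\<^sup>2" by simp
      also have "\<dots> = (l * L * D)\<^sup>2 + S / (4 * D\<^sup>2) - l * L * sqrt S"
        using D S by (simp add: power2_diff power_divide power_mult_distrib)
      finally show ?thesis by simp
    qed
    finally have "l * F x - (l * L * D)\<^sup>2 \<le> l * F y + S / (4 * D\<^sup>2)" by simp
    then have "exp (l * F x - (l * L * D)\<^sup>2) \<le> exp (l * F y + S / (4 * D\<^sup>2))" by simp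
    then show "ennreal (exp (l * F x) / c) \<le> ennreal (exp (l * F y + (\<Sum>i\<in>I. (x i - y i)\<^sup>2) / (4 * (b - a)\<^sup>2)))"
      by (intro ennreal_leI) (simp add: c_def exp_diff S_def D_def)
  qed (simp_all add: sets_\<nu>)
  also have "(\<integral>\<^sup>+x. ennreal (exp (l * F x) / c) \<partial>PiM I \<nu>) = (\<integral>\<^sup>+\<omega>. ennreal (exp (l * F (?Y \<omega>)) / c) \<partial>M)"
    using meas by (subst tr) auto
  also have "(\<integral>\<^sup>+x. ennreal (exp (- (l * F x))) \<partial>PiM I \<nu>) = (\<integral>\<^sup>+\<omega>. ennreal (exp (- (l * F (?Y \<omega>)))) \<partial>M)"
    using meas by (subst tr) auto
  finally have 1: "(\<integral>\<^sup>+\<omega>. ennreal (exp (l * F (?Y \<omega>)) / c) \<partial>M) * (\<integral>\<^sup>+\<omega>. ennreal (exp (- (l * F (?Y \<omega>)))) \<partial>M) \<le> 1"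
    (is "?A * ?B \<le> 1") .
  have c: "c > 0" by (simp add: c_def)
  have Fm': "(\<lambda>\<omega>. F (?Y \<omega>)) \<in> borel_measurable M" by (rule measurable_compose[OF Ym meas])
  have "(\<integral>\<^sup>+\<omega>. ennreal (exp (l * F (?Y \<omega>))) \<partial>M) = (\<integral>\<^sup>+\<omega>. ennreal c * ennreal (exp (l * F (?Y \<omega>)) / c) \<partial>M)"
    using c by (intro nn_integral_cong) (simp add: ennreal_mult[symmetric])
  also have "\<dots> = ennreal c * ?A"
    using Fm' by (intro nn_integral_cmult) auto
  finally have "(\<integral>\<^sup>+\<omega>. ennreal (exp (l * F (?Y \<omega>))) \<partial>M) * ?B = ennreal c * (?A * ?B)"
    by (simp add: mult.assoc)
  also have "\<dots> \<le> ennreal c * 1" by (intro mult_left_mono 1) auto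
  finally show ?thesis by (simp add: c_def D_def)
qed

text \<open>
  After centring, both exponential moments are at least $1$ by Jensen's inequality, so the bound on their product
  bounds each of them. This is how the lower tail is obtained, although $-F$ is not convex. The
  Chernoff bound is then optimised at $l = \epsilon/(2V)$.
\<close>

lemma convex_concentration:
  fixes Y :: "'i \<Rightarrow> 'a \<Rightarrow> real" and F :: "('i \<Rightarrow> real) \<Rightarrow> real"
  assumes ab: "a < b" and I: "finite I" "I \<noteq> {}" and indep: "indep_vars (\<lambda>_. borel) Y I"
    and Y: "\<And>i \<omega>. i \<in> I \<Longrightarrow> \<omega> \<in> space M \<Longrightarrow> Y i \<omega> \<in> {a..b}"
    and conv: "fun_convex F" and meas: "F \<in> borel_measurable (PiM I (\<lambda>_. borel))"
    and lip: "\<And>x y. F x - F y \<le> L * sqrt (\<Sum>i\<in>I. (x i - y i)\<^sup>2)" and L: "0 < L" and \<epsilon>: "0 < \<epsilon>"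
  shows "prob {\<omega>\<in>space M. \<epsilon> \<le> \<bar>F (\<lambda>i\<in>I. Y i \<omega>) - expectation (\<lambda>\<omega>. F (\<lambda>i\<in>I. Y i \<omega>))\<bar>}
      \<le> 2 * exp (- \<epsilon>\<^sup>2 / (4 * (L * (b - a))\<^sup>2))"
proof -
  define Z where "Z \<omega> = F (\<lambda>i\<in>I. Y i \<omega>)" for \<omega>
  define c where "c = expectation Z"
  define V where "V = (L * (b - a))\<^sup>2"
  have V: "V > 0" using L ab by (simp add: V_def)
  have [measurable]: "random_variable borel (Y i)" if "i \<in> I" for i
    using indep that by (auto simp: indep_vars_def2)
  have [measurable]: "Z \<in> borel_measurable M"
    unfolding Z_def by (rule measurable_compose[OF _ meas]) (intro measurable_restrict, auto)
  obtain B where B: "\<And>\<omega>. \<omega> \<in> space M \<Longrightarrow> \<bar>Z \<omega>\<bar> \<le> B"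
  proof
    fix \<omega> assume \<omega>: "\<omega> \<in> space M"
    let ?y = "\<lambda>i\<in>I. Y i \<omega>" and ?a = "\<lambda>_. a"
    let ?C = "L * sqrt (\<Sum>i\<in>I. (b - a)\<^sup>2)"
    have le: "(\<Sum>i\<in>I. (?y i - ?a i)\<^sup>2) \<le> (\<Sum>i\<in>I. (b - a)\<^sup>2)"
      using Y[OF _ \<omega>] by (intro sum_mono) (auto intro!: power_mono)
    have "F ?y - F ?a \<le> ?C"
      using lip[of ?y ?a] L le by (smt (verit) mult_left_mono real_sqrt_le_mono)
    moreover have "F ?a - F ?y \<le> ?C"
      using lip[of ?a ?y] L le by (smt (verit) mult_left_mono real_sqrt_le_mono power2_commute sum.cong)
    ultimately show "\<bar>Z \<omega>\<bar> \<le> \<bar>F ?a\<bar> + ?C" by (simp add: Z_def)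
  qed
  have Zint: "integrable M Z"
    using B by (intro integrable_const_bound[where B=B]) auto
  have expint: "integrable M (\<lambda>\<omega>. exp (s * (Z \<omega> - c)))" for s
  proof (rule integrable_const_bound)
    show "AE \<omega> in M. norm (exp (s * (Z \<omega> - c))) \<le> exp (\<bar>s\<bar> * (B + \<bar>c\<bar>))"
    proof (rule AE_I2)
      fix \<omega> assume "\<omega> \<in> space M"
      have "s * (Z \<omega> - c) \<le> \<bar>s\<bar> * \<bar>Z \<omega> - c\<bar>" by (metis abs_ge_self abs_mult)
      also have "\<dots> \<le> \<bar>s\<bar> * (B + \<bar>c\<bar>)"
        using B[OF \<open>\<omega> \<in> space M\<close>] by (intro mult_left_mono) auto
      finally show "norm (exp (s * (Z \<omega> - c))) \<le> exp (\<bar>s\<bar> * (B + \<bar>c\<bar>))" by simp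
    qed
  qed measurable
  have jensen: "1 \<le> expectation (\<lambda>\<omega>. exp (s * (Z \<omega> - c)))" for s
  proof -
    have "1 = expectation (\<lambda>\<omega>. 1 + s * (Z \<omega> - c))"
      using Zint by (simp add: prob_space c_def)
    also have "\<dots> \<le> expectation (\<lambda>\<omega>. exp (s * (Z \<omega> - c)))"
      using Zint by (intro integral_mono expint) (auto intro: exp_ge_add_one_self)
    finally show ?thesis .
  qed
  have nn: "(\<integral>\<^sup>+\<omega>. ennreal (exp (s * (Z \<omega> - c))) \<partial>M) = ennreal (expectation (\<lambda>\<omega>. exp (s * (Z \<omega> - c))))" for s
    by (intro nn_integral_eq_integral expint) auto
  define l where "l = \<epsilon> / (2 * V)"
  have l: "l > 0" using \<epsilon> V by (simp add: l_def)
  let ?P = "expectation (\<lambda>\<omega>. exp (l * (Z \<omega> - c)))" and ?N = "expectation (\<lambda>\<omega>. exp (- l * (Z \<omega> - c)))"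
  have "ennreal (?P * ?N) \<le> ennreal (exp (l\<^sup>2 * V))"
  proof -
    have "ennreal (?P * ?N) = (\<integral>\<^sup>+\<omega>. ennreal (exp (l * (Z \<omega> - c))) \<partial>M) * (\<integral>\<^sup>+\<omega>. ennreal (exp (- l * (Z \<omega> - c))) \<partial>M)"
      using jensen[of l] jensen[of "- l"] by (simp only: nn) (intro ennreal_mult; linarith)
    also have "(\<integral>\<^sup>+\<omega>. ennreal (exp (l * (Z \<omega> - c))) \<partial>M) = (\<integral>\<^sup>+\<omega>. ennreal (exp (- (l * c))) * ennreal (exp (l * Z \<omega>)) \<partial>M)"
      by (intro nn_integral_cong) (simp add: ennreal_mult[symmetric] exp_add[symmetric] algebra_simps)
    also have "\<dots> = ennreal (exp (- (l * c))) * (\<integral>\<^sup>+\<omega>. ennreal (exp (l * Z \<omega>)) \<partial>M)"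
      by (intro nn_integral_cmult) measurable
    also have "(\<integral>\<^sup>+\<omega>. ennreal (exp (- l * (Z \<omega> - c))) \<partial>M) = (\<integral>\<^sup>+\<omega>. ennreal (exp (l * c)) * ennreal (exp (- (l * Z \<omega>))) \<partial>M)"
      by (intro nn_integral_cong) (simp add: ennreal_mult[symmetric] exp_add[symmetric] algebra_simps)
    also have "\<dots> = ennreal (exp (l * c)) * (\<integral>\<^sup>+\<omega>. ennreal (exp (- (l * Z \<omega>))) \<partial>M)"
      by (intro nn_integral_cmult) measurable
    also have "ennreal (exp (- (l * c))) * (\<integral>\<^sup>+\<omega>. ennreal (exp (l * Z \<omega>)) \<partial>M) * \<dots> =
      (ennreal (exp (- (l * c))) * ennreal (exp (l * c))) *
      ((\<integral>\<^sup>+\<omega>. ennreal (exp (l * Z \<omega>)) \<partial>M) * (\<integral>\<^sup>+\<omega>. ennreal (exp (- (l * Z \<omega>))) \<partial>M))"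
      by (simp only: mult_ac)
    also have "ennreal (exp (- (l * c))) * ennreal (exp (l * c)) = 1"
      by (simp add: ennreal_mult[symmetric] exp_minus)
    also have "1 * ((\<integral>\<^sup>+\<omega>. ennreal (exp (l * Z \<omega>)) \<partial>M) * (\<integral>\<^sup>+\<omega>. ennreal (exp (- (l * Z \<omega>))) \<partial>M))
       \<le> ennreal (exp ((l * L * (b - a))\<^sup>2))"
      unfolding Z_def mult_1
      using l by (intro maurey_indep_vars[OF ab I indep Y conv meas lip]) auto
    also have "(l * L * (b - a))\<^sup>2 = l\<^sup>2 * V" by (simp add: V_def power_mult_distrib)
    finally show ?thesis .
  qed
  then have PN: "?P * ?N \<le> exp (l\<^sup>2 * V)" by simp
  have "?P * 1 \<le> ?P * ?N" "1 * ?N \<le> ?P * ?N"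
    using jensen[of l] jensen[of "- l"] by (intro mult_left_mono mult_right_mono; linarith)+
  then have P: "?P \<le> exp (l\<^sup>2 * V)" and N: "?N \<le> exp (l\<^sup>2 * V)"
    using PN by linarith+
  have chernoff: "prob {\<omega>\<in>space M. \<epsilon> \<le> s * (Z \<omega> - c)} \<le> exp (- l * \<epsilon>) * exp (l\<^sup>2 * V)"
    if "expectation (\<lambda>\<omega>. exp (l * (s * (Z \<omega> - c)))) \<le> exp (l\<^sup>2 * V)" for s
  proof -
    have "prob {\<omega>\<in>space M. \<epsilon> \<le> s * (Z \<omega> - c)} \<le> exp (- l * \<epsilon>) * (\<integral>\<omega>\<in>space M. exp (l * (s * (Z \<omega> - c))) \<partial>M)"
    proof (rule Chernoff_ineq_ge[OF l])
      show "set_integrable M (space M) (\<lambda>\<omega>. exp (l * (s * (Z \<omega> - c))))"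
        unfolding set_integrable_def using expint[of "l * s"]
        by (intro integrable_mult_indicator) (simp_all add: mult.assoc)
    qed auto
    also have "(\<integral>\<omega>\<in>space M. exp (l * (s * (Z \<omega> - c))) \<partial>M) \<le> exp (l\<^sup>2 * V)"
      using that expint[of "l * s"] by (simp add: set_integral_space mult.assoc)
    finally show ?thesis by simp
  qed
  have rate: "exp (- l * \<epsilon>) * exp (l\<^sup>2 * V) = exp (- \<epsilon>\<^sup>2 / (4 * V))"
    using V by (simp add: exp_add[symmetric] l_def power2_eq_square field_simps)
  have "{\<omega>\<in>space M. \<epsilon> \<le> \<bar>Z \<omega> - c\<bar>} = {\<omega>\<in>space M. \<epsilon> \<le> 1 * (Z \<omega> - c)} \<union> {\<omega>\<in>space M. \<epsilon> \<le> - 1 * (Z \<omega> - c)}"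
    by auto
  then have "prob {\<omega>\<in>space M. \<epsilon> \<le> \<bar>Z \<omega> - c\<bar>}
      \<le> prob {\<omega>\<in>space M. \<epsilon> \<le> 1 * (Z \<omega> - c)} + prob {\<omega>\<in>space M. \<epsilon> \<le> - 1 * (Z \<omega> - c)}"
    by (simp only:) (rule measure_Un_le; measurable)
  also have "\<dots> \<le> exp (- \<epsilon>\<^sup>2 / (4 * V)) + exp (- \<epsilon>\<^sup>2 / (4 * V))"
  proof (intro add_mono)
    have "l * (1 * (Z \<omega> - c)) = l * (Z \<omega> - c)" "l * (- 1 * (Z \<omega> - c)) = - l * (Z \<omega> - c)" for \<omega>
      by (simp_all add: algebra_simps)
    then show "prob {\<omega>\<in>space M. \<epsilon> \<le> 1 * (Z \<omega> - c)} \<le> exp (- \<epsilon>\<^sup>2 / (4 * V))"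
      "prob {\<omega>\<in>space M. \<epsilon> \<le> - 1 * (Z \<omega> - c)} \<le> exp (- \<epsilon>\<^sup>2 / (4 * V))"
      using chernoff[of 1] chernoff[of "- 1"] P N unfolding rate by (simp_all only:)
  qed
  finally show ?thesis by (simp add: Z_def[abs_def] c_def V_def)
qed

end

section \<open>The central limit theorem for a single eigenvalue\<close>

text \<open>
  The upper bound comes from $1 \le 1 + u^3 = (1 + u)(1 - u + u^2) \le e^u (1 - u + u^2)$.
\<close>

lemma exp_minus_quadratic_bound:
  assumes "0 \<le> (u::real)"
  shows "\<bar>exp (- u) - (1 - u)\<bar> \<le> u\<^sup>2"
proof -
  have "1 + (- u) \<le> exp (- u)" by (rule exp_ge_add_one_self)
  moreover have "exp (- u) \<le> 1 - u + u\<^sup>2"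
  proof -
    have "1 * 1 \<le> (1 + u) * (1 - u + u\<^sup>2)"
      using assms by (simp add: algebra_simps power2_eq_square)
    also have "\<dots> \<le> exp u * (1 - u + u\<^sup>2)"
    proof (intro mult_right_mono)
      have "0 \<le> (1 - u)\<^sup>2 + u" using assms by simp
      then show "0 \<le> 1 - u + u\<^sup>2" by (simp add: power2_eq_square algebra_simps)
    qed (rule exp_ge_add_one_self)
    finally show ?thesis by (simp add: exp_minus divide_simps mult.commute)
  qed
  ultimately show ?thesis by (simp add: abs_le_iff)
qed

context prob_space
begin

lemma third_moment_integrable:
  assumes [measurable]: "random_variable borel X" and C: "(\<integral>\<^sup>+\<omega>. ennreal (\<bar>X \<omega>\<bar> ^ 3) \<partial>M) \<le> ennreal C" "0 \<le> C"
  shows "integrable M (\<lambda>\<omega>. \<bar>X \<omega>\<bar> ^ 3)" and "expectation (\<lambda>\<omega>. \<bar>X \<omega>\<bar> ^ 3) \<le> C"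
    and "integrable M (\<lambda>\<omega>. (X \<omega>)\<^sup>2)" and "integrable M X"
proof -
  show int3: "integrable M (\<lambda>\<omega>. \<bar>X \<omega>\<bar> ^ 3)"
    using C by (intro integrableI_bounded) (auto simp: power_abs intro: le_less_trans)
  show "expectation (\<lambda>\<omega>. \<bar>X \<omega>\<bar> ^ 3) \<le> C" by (rule integral_real_bounded[OF C(2,1)])
  have int: "integrable M (\<lambda>\<omega>. 1 + \<bar>X \<omega>\<bar> ^ 3)" using int3 by simp
  have bounds: "x\<^sup>2 \<le> 1 + \<bar>x\<bar> ^ 3" "\<bar>x\<bar> \<le> 1 + \<bar>x\<bar> ^ 3" for x :: real
  proof -
    consider "\<bar>x\<bar> \<le> 1" | "1 \<le> \<bar>x\<bar>" by linarith
    then have "\<bar>x\<bar> \<le> 1 + \<bar>x\<bar> ^ 3 \<and> \<bar>x\<bar>\<^sup>2 \<le> 1 + \<bar>x\<bar> ^ 3"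
    proof cases
      case 1
      then have "\<bar>x\<bar>\<^sup>2 \<le> 1" using abs_square_le_1[of x] by simp
      moreover have "0 \<le> \<bar>x\<bar> ^ 3" by simp
      ultimately show ?thesis using 1 by linarith
    next
      case 2
      then have "\<bar>x\<bar> ^ 1 \<le> \<bar>x\<bar> ^ 3" "\<bar>x\<bar> ^ 2 \<le> \<bar>x\<bar> ^ 3" by (intro power_increasing; simp)+
      then show ?thesis by simp
    qed
    then show "x\<^sup>2 \<le> 1 + \<bar>x\<bar> ^ 3" "\<bar>x\<bar> \<le> 1 + \<bar>x\<bar> ^ 3" by simp_all
  qed
  show "integrable M (\<lambda>\<omega>. (X \<omega>)\<^sup>2)" "integrable M X"
    using bounds by (auto intro!: Bochner_Integration.integrable_bound[OF int] AE_I2 simp: power_abs)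
qed

lemma third_moment_centered:
  fixes X :: "'a \<Rightarrow> real" and m :: real
  assumes [measurable]: "random_variable borel X" and int3: "integrable M (\<lambda>\<omega>. \<bar>X \<omega>\<bar> ^ 3)"
    and C: "expectation (\<lambda>\<omega>. \<bar>X \<omega>\<bar> ^ 3) \<le> C"
  shows "integrable M (\<lambda>\<omega>. \<bar>X \<omega> - m\<bar> ^ 3)" and "expectation (\<lambda>\<omega>. \<bar>X \<omega> - m\<bar> ^ 3) \<le> 8 * (C + \<bar>m\<bar> ^ 3)"
proof -
  have le: "\<bar>x - m\<bar> ^ 3 \<le> 8 * (\<bar>x\<bar> ^ 3 + \<bar>m\<bar> ^ 3)" for x :: real
  proof -
    let ?M = "max \<bar>x\<bar> \<bar>m\<bar>"
    have "\<bar>x - m\<bar> ^ 3 \<le> (2 * ?M) ^ 3" by (rule power_mono) auto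
    also have "\<dots> = 8 * ?M ^ 3" by (simp add: power_mult_distrib)
    also have "?M ^ 3 \<le> \<bar>x\<bar> ^ 3 + \<bar>m\<bar> ^ 3" by (simp add: max_def)
    finally show ?thesis by simp
  qed
  have int: "integrable M (\<lambda>\<omega>. 8 * (\<bar>X \<omega>\<bar> ^ 3 + \<bar>m\<bar> ^ 3))" using int3 by simp
  show int': "integrable M (\<lambda>\<omega>. \<bar>X \<omega> - m\<bar> ^ 3)"
  proof (rule Bochner_Integration.integrable_bound[OF int])
    show "AE \<omega> in M. norm (\<bar>X \<omega> - m\<bar> ^ 3) \<le> norm (8 * (\<bar>X \<omega>\<bar> ^ 3 + \<bar>m\<bar> ^ 3))"
      using le by (intro AE_I2) (simp add: power_abs)
  qed measurable
  have "expectation (\<lambda>\<omega>. \<bar>X \<omega> - m\<bar> ^ 3) \<le> expectation (\<lambda>\<omega>. 8 * (\<bar>X \<omega>\<bar> ^ 3 + \<bar>m\<bar> ^ 3))"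
    by (rule integral_mono[OF int' int le])
  also have "\<dots> \<le> 8 * (C + \<bar>m\<bar> ^ 3)" using C int3 by (simp add: prob_space)
  finally show "expectation (\<lambda>\<omega>. \<bar>X \<omega> - m\<bar> ^ 3) \<le> 8 * (C + \<bar>m\<bar> ^ 3)" .
qed

lemma circ_eig_random_variable:
  assumes X: "\<And>j. j \<ge> 1 \<Longrightarrow> random_variable borel (X j)"
  shows "random_variable borel (\<lambda>\<omega>. circ_eig n (\<lambda>j. X j \<omega>) k)"
proof (cases "n = 0")
  case False
  have [measurable]: "random_variable borel (X j)" if "j \<in> {1..n div 2 + 1}" for j
    using that by (intro X) simp
  from False show ?thesis by (simp only: circ_eig_coeff neq0_conv) measurable
qed (simp add: circ_eig_def)

text \<open>
  Both characteristic functions are compared with the common second order Taylor polynomial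
  $1 - s^2v/2$.
\<close>

lemma char_third_moment_gaussian_bound:
  assumes Z[measurable]: "random_variable borel Z" and int3: "integrable M (\<lambda>\<omega>. \<bar>Z \<omega>\<bar> ^ 3)"
    and int2: "integrable M (\<lambda>\<omega>. (Z \<omega>)\<^sup>2)" and int1: "integrable M Z"
    and mean: "expectation Z = 0" and var: "expectation (\<lambda>\<omega>. (Z \<omega>)\<^sup>2) = v"
    and C: "expectation (\<lambda>\<omega>. \<bar>Z \<omega>\<bar> ^ 3) \<le> C"
  shows "cmod (char (distr M borel Z) s - exp (- (s\<^sup>2 * v / 2))) \<le> \<bar>s\<bar> ^ 3 * C / 6 + (s\<^sup>2 * v / 2)\<^sup>2"
proof -
  let ?u = "s\<^sup>2 * v / 2"
  have v: "v \<ge> 0" unfolding var[symmetric] by (intro integral_nonneg_AE) auto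
  have "cmod (char (distr M borel Z) s - (1 - ?u))
      \<le> (s\<^sup>2 / 6) * expectation (\<lambda>\<omega>. min (6 * (Z \<omega>)\<^sup>2) (\<bar>s\<bar> * \<bar>Z \<omega>\<bar> ^ 3))"
    using char_approx3'[OF Z int1 int2 mean, of v "distr M borel Z" s] mean var by simp
  also have "\<dots> \<le> (s\<^sup>2 / 6) * expectation (\<lambda>\<omega>. \<bar>s\<bar> * \<bar>Z \<omega>\<bar> ^ 3)"
    using int3 int2 by (intro mult_left_mono integral_mono) auto
  also have "\<dots> \<le> (s\<^sup>2 / 6) * (\<bar>s\<bar> * C)"
    using C by (intro mult_left_mono) (auto intro: mult_left_mono)
  also have "\<dots> = \<bar>s\<bar> ^ 3 * C / 6"
    by (simp add: power3_eq_cube power2_eq_square abs_mult_self_eq)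
  finally have 1: "cmod (char (distr M borel Z) s - (1 - ?u)) \<le> \<bar>s\<bar> ^ 3 * C / 6" .
  have "cmod (complex_of_real (1 - ?u) - complex_of_real (exp (- ?u))) \<le> ?u\<^sup>2"
    using exp_minus_quadratic_bound[of ?u] v
    unfolding of_real_diff[symmetric] norm_of_real by (simp add: abs_minus_commute)
  then have 2: "cmod ((1 - ?u) - exp (- ?u)) \<le> ?u\<^sup>2" by simp
  show ?thesis
    using norm_triangle_le[of "char (distr M borel Z) s - (1 - ?u)" "(1 - ?u) - exp (- ?u)"] 1 2
    by (simp add: norm_triangle_le)
qed

text \<open>
  The frequency may vary with \<open>n\<close>: choosing the worst admissible one for each \<open>n\<close> then makes the
  limit uniform in the frequency. The characteristic function is a product over the entries, which is compared with a
  Gaussian product factor by factor: each factor contributes $O(n^{-3/2})$, and there are at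
  most $n + 1$ of them.
\<close>

lemma circ_eig_clt:
  fixes Z :: "nat \<Rightarrow> 'a \<Rightarrow> real"
  assumes indep: "indep_vars (\<lambda>_. borel) Z {1..}"
    and int3: "\<And>j. j \<ge> 1 \<Longrightarrow> integrable M (\<lambda>\<omega>. \<bar>Z j \<omega>\<bar> ^ 3)"
    and int2: "\<And>j. j \<ge> 1 \<Longrightarrow> integrable M (\<lambda>\<omega>. (Z j \<omega>)\<^sup>2)" and int1: "\<And>j. j \<ge> 1 \<Longrightarrow> integrable M (Z j)"
    and mean: "\<And>j. j \<ge> 1 \<Longrightarrow> expectation (Z j) = 0"
    and var: "\<And>j. j \<ge> 1 \<Longrightarrow> expectation (\<lambda>\<omega>. (Z j \<omega>)\<^sup>2) = \<sigma>\<^sup>2"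
    and C: "\<And>j. j \<ge> 1 \<Longrightarrow> expectation (\<lambda>\<omega>. \<bar>Z j \<omega>\<bar> ^ 3) \<le> C" and \<sigma>: "\<sigma> > 0"
    and k: "eventually (\<lambda>n. \<not> n dvd 2 * k n) sequentially"
  shows "weak_conv_m (\<lambda>n. distr M borel (\<lambda>\<omega>. 1 / (\<sigma> * sqrt (real n)) * circ_eig n (\<lambda>j. Z j \<omega>) (k n)))
     std_normal_distribution"
proof (rule levy_continuity)
  have rv [measurable]: "random_variable borel (Z j)" if "j \<ge> 1" for j
    using indep that by (auto simp: indep_vars_def2)
  let ?I = "\<lambda>n. {1..n div 2 + 1}"
  define a where "a n j = 1 / (\<sigma> * sqrt (real n)) * circ_coeff n (k n) j" for n j
  define S where "S n \<omega> = 1 / (\<sigma> * sqrt (real n)) * circ_eig n (\<lambda>j. Z j \<omega>) (k n)" for n \<omega>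
  have S_eq: "S n = (\<lambda>\<omega>. \<Sum>j\<in>?I n. a n j * Z j \<omega>)" if "n > 0" for n
    using that by (simp only: S_def[abs_def] circ_eig_coeff sum_distrib_left a_def mult.assoc)
  have S_meas: "S n \<in> borel_measurable M" for n
  proof (cases "n = 0")
    case False
    then show ?thesis by (subst S_eq) auto
  qed (simp add: S_def[abs_def])
  show "real_distribution (distr M borel (\<lambda>\<omega>. 1 / (\<sigma> * sqrt (real n)) * circ_eig n (\<lambda>j. Z j \<omega>) (k n)))" for n
    using S_meas[of n] by (intro real_distribution_distr) (simp add: S_def[abs_def])
  show "real_distribution std_normal_distribution" by (rule real_dist_normal_dist)
  fix t :: real
  have C0: "0 \<le> C"
    using C[of 1] by (auto intro: order_trans[rotated] integral_nonneg_AE)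
  define s where "s n = (\<Sum>j\<in>?I n. (t * a n j)\<^sup>2 * \<sigma>\<^sup>2 / 2)" for n
  define K1 where "K1 = (2 * \<bar>t\<bar> / \<sigma>) ^ 3 * C / 6"
  define K2 where "K2 = ((2 * \<bar>t\<bar> / \<sigma>)\<^sup>2 * \<sigma>\<^sup>2 / 2)\<^sup>2"
  define r where "r n = 1 / sqrt (real n)" for n :: nat
  have bound: "cmod (char (distr M borel (S n)) t - exp (- s n)) \<le> (real n + 1) * (K1 * r n ^ 3 + K2 * r n ^ 4)"
    if n: "n > 0" for n
  proof -
    have char_S: "char (distr M borel (S n)) t = (\<Prod>j\<in>?I n. char (distr M borel (Z j)) (t * a n j))"
    proof -
      have "indep_vars (\<lambda>_. borel) (\<lambda>j \<omega>. a n j * Z j \<omega>) (?I n)"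
        by (intro indep_vars_compose2[OF indep_vars_subset[OF indep]]) auto
      then have "char (distr M borel (S n)) t = (\<Prod>j\<in>?I n. char (distr M borel (\<lambda>\<omega>. a n j * Z j \<omega>)) t)"
        unfolding S_eq[OF n] by (rule char_distr_sum)
      also have "\<dots> = (\<Prod>j\<in>?I n. char (distr M borel (Z j)) (t * a n j))"
        by (intro prod.cong refl) (simp add: char_def integral_distr mult.assoc)
      finally show ?thesis .
    qed
    have exp_s: "complex_of_real (exp (- s n)) = (\<Prod>j\<in>?I n. complex_of_real (exp (- ((t * a n j)\<^sup>2 * \<sigma>\<^sup>2 / 2))))"
      by (simp only: s_def sum_negf[symmetric] exp_sum finite_atLeastAtMost of_real_prod)
    have "cmod (char (distr M borel (S n)) t - exp (- s n)) \<le>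
       (\<Sum>j\<in>?I n. cmod (char (distr M borel (Z j)) (t * a n j) - exp (- ((t * a n j)\<^sup>2 * \<sigma>\<^sup>2 / 2))))"
      unfolding char_S exp_s
    proof (rule norm_prod_diff)
      fix j assume j: "j \<in> ?I n"
      show "cmod (char (distr M borel (Z j)) (t * a n j)) \<le> 1"
        using j by (intro real_distribution.cmod_char_le_1 real_distribution_distr) auto
      show "cmod (complex_of_real (exp (- ((t * a n j)\<^sup>2 * \<sigma>\<^sup>2 / 2)))) \<le> 1"
        unfolding norm_of_real by simp
    qed
    also have "\<dots> \<le> (\<Sum>j\<in>?I n. K1 * r n ^ 3 + K2 * r n ^ 4)"
    proof (rule sum_mono)
      fix j assume "j \<in> ?I n"
      then have j: "j \<ge> 1" by simp
      define u where "u = t * a n j"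
      have "\<bar>u\<bar> = \<bar>t\<bar> * \<bar>circ_coeff n (k n) j\<bar> / \<sigma> * r n"
        using \<sigma> by (simp add: u_def a_def r_def abs_mult)
      also have "\<dots> \<le> \<bar>t\<bar> * 2 / \<sigma> * r n"
        using \<sigma> by (intro mult_right_mono divide_right_mono mult_left_mono abs_circ_coeff_le) (auto simp: r_def)
      finally have u: "\<bar>u\<bar> \<le> (2 * \<bar>t\<bar> / \<sigma>) * r n" by (simp add: mult.commute)
      have u3: "\<bar>u\<bar> ^ 3 * C / 6 \<le> K1 * r n ^ 3"
      proof -
        have "\<bar>u\<bar> ^ 3 \<le> ((2 * \<bar>t\<bar> / \<sigma>) * r n) ^ 3" by (rule power_mono[OF u]) simp
        then have "\<bar>u\<bar> ^ 3 * C / 6 \<le> ((2 * \<bar>t\<bar> / \<sigma>) * r n) ^ 3 * C / 6"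
          using C0 by (intro divide_right_mono mult_right_mono) auto
        also have "\<dots> = K1 * r n ^ 3"
          unfolding K1_def power_mult_distrib[of "2 * \<bar>t\<bar> / \<sigma>" "r n"]
          by (simp only: mult_ac times_divide_eq_left times_divide_eq_right)
        finally show ?thesis .
      qed
      have u4: "(u\<^sup>2 * \<sigma>\<^sup>2 / 2)\<^sup>2 \<le> K2 * r n ^ 4"
      proof -
        have "u\<^sup>2 \<le> ((2 * \<bar>t\<bar> / \<sigma>) * r n)\<^sup>2"
          using power_mono[OF u, of 2] by simp
        then have "u\<^sup>2 * \<sigma>\<^sup>2 / 2 \<le> ((2 * \<bar>t\<bar> / \<sigma>) * r n)\<^sup>2 * \<sigma>\<^sup>2 / 2"
          by (intro divide_right_mono mult_right_mono) auto
        then have "(u\<^sup>2 * \<sigma>\<^sup>2 / 2)\<^sup>2 \<le> (((2 * \<bar>t\<bar> / \<sigma>) * r n)\<^sup>2 * \<sigma>\<^sup>2 / 2)\<^sup>2"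
          by (rule power_mono) simp
        also have "\<dots> = K2 * r n ^ 4"
          unfolding K2_def by (simp add: power_mult_distrib power_divide mult_ac)
        finally show ?thesis .
      qed
      show "cmod (char (distr M borel (Z j)) (t * a n j) - exp (- ((t * a n j)\<^sup>2 * \<sigma>\<^sup>2 / 2)))
        \<le> K1 * r n ^ 3 + K2 * r n ^ 4"
        using char_third_moment_gaussian_bound[OF rv[OF j] int3[OF j] int2[OF j] int1[OF j] mean[OF j] var[OF j] C[OF j], of u]
          u3 u4 unfolding u_def by linarith
    qed
    also have "\<dots> = real (n div 2 + 1) * (K1 * r n ^ 3 + K2 * r n ^ 4)" by simp
    also have "\<dots> \<le> (real n + 1) * (K1 * r n ^ 3 + K2 * r n ^ 4)"
    proof (rule mult_right_mono)
      show "real (n div 2 + 1) \<le> real n + 1" by linarith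
      show "0 \<le> K1 * r n ^ 3 + K2 * r n ^ 4"
        using C0 \<sigma> by (auto simp: K1_def K2_def r_def intro!: add_nonneg_nonneg mult_nonneg_nonneg)
    qed
    finally show ?thesis .
  qed
  have lim0: "(\<lambda>n. (real n + 1) * (K1 * r n ^ 3 + K2 * r n ^ 4)) \<longlonglongrightarrow> 0"
    unfolding r_def by real_asymp
  have lim1: "(\<lambda>n. char (distr M borel (S n)) t - exp (- s n)) \<longlonglongrightarrow> 0"
  proof (rule Lim_null_comparison[OF _ lim0])
    show "eventually (\<lambda>n. norm (char (distr M borel (S n)) t - exp (- s n))
        \<le> (real n + 1) * (K1 * r n ^ 3 + K2 * r n ^ 4)) sequentially"
      using eventually_gt_at_top[of "0::nat"] by eventually_elim (rule bound)
  qed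
  have s_lim: "s \<longlonglongrightarrow> t\<^sup>2 / 2"
  proof (rule tendsto_sandwich)
    have s_eq: "s n = t\<^sup>2 / 2 * ((\<Sum>j\<in>?I n. (circ_coeff n (k n) j)\<^sup>2) / real n)" if "n > 0" for n
    proof -
      have "s n = (\<Sum>j\<in>?I n. t\<^sup>2 / 2 * ((circ_coeff n (k n) j)\<^sup>2 / real n))"
        unfolding s_def a_def using \<sigma> that
        by (intro sum.cong refl) (simp add: power_mult_distrib power_divide)
      then show ?thesis by (simp only: sum_distrib_left sum_divide_distrib)
    qed
    show "eventually (\<lambda>n. t\<^sup>2 / 2 * ((real n - 2) / real n) \<le> s n) sequentially"
      using k eventually_gt_at_top[of 0]
    proof eventually_elim
      case (elim n)
      show ?case unfolding s_eq[OF elim(2)]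
        by (intro mult_left_mono divide_right_mono sum_circ_coeff_squares elim) auto
    qed
    show "eventually (\<lambda>n. s n \<le> t\<^sup>2 / 2 * (real n / real n)) sequentially"
      using k eventually_gt_at_top[of 0]
    proof eventually_elim
      case (elim n)
      show ?case unfolding s_eq[OF elim(2)]
        by (intro mult_left_mono divide_right_mono sum_circ_coeff_squares elim) auto
    qed
    show "(\<lambda>n. t\<^sup>2 / 2 * ((real n - 2) / real n)) \<longlonglongrightarrow> t\<^sup>2 / 2"
      by real_asymp
    show "(\<lambda>n. t\<^sup>2 / 2 * (real n / real n)) \<longlonglongrightarrow> t\<^sup>2 / 2"
      by real_asymp
  qed
  have "(\<lambda>n. complex_of_real (exp (- s n))) \<longlonglongrightarrow> complex_of_real (exp (- (t\<^sup>2 / 2)))"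
    by (intro tendsto_intros s_lim)
  from tendsto_add[OF lim1 this]
  have "(\<lambda>n. char (distr M borel (S n)) t) \<longlonglongrightarrow> complex_of_real (exp (- (t\<^sup>2 / 2)))" by simp
  then show "(\<lambda>n. char (distr M borel (\<lambda>\<omega>. 1 / (\<sigma> * sqrt (real n)) * circ_eig n (\<lambda>j. Z j \<omega>) (k n))) t)
      \<longlonglongrightarrow> char std_normal_distribution t"
    unfolding S_def[abs_def] char_std_normal_distribution by simp
qed

end

section \<open>Piecewise linear statistics of the spectrum\<close>

definition hinge_mean :: "nat \<Rightarrow> real \<Rightarrow> real \<Rightarrow> (nat \<Rightarrow> real) \<Rightarrow> real" where
  "hinge_mean n s c x = (\<Sum>k<n. max 0 (s * circ_eig n x k - c)) / real n"

lemma hinge_mean_convex: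
  "fun_convex (hinge_mean n s c)"
  unfolding fun_convex_def
proof (intro allI impI)
  fix t :: real and x y :: "nat \<Rightarrow> real" assume t: "0 \<le> t" "t \<le> 1"
  let ?h = "\<lambda>x k. max 0 (s * circ_eig n x k - c)"
  have "?h (\<lambda>i. (1 - t) * x i + t * y i) k \<le> (1 - t) * ?h x k + t * ?h y k" for k
  proof -
    have "s * circ_eig n (\<lambda>i. (1 - t) * x i + t * y i) k - c
        = (1 - t) * (s * circ_eig n x k - c) + t * (s * circ_eig n y k - c)"
      unfolding circ_eig_convex_comb by (simp add: algebra_simps)
    also have "\<dots> \<le> (1 - t) * ?h x k + t * ?h y k"
      using t by (intro add_mono mult_left_mono) auto
    finally show ?thesis using t by simp
  qed
  then have "(\<Sum>k<n. ?h (\<lambda>i. (1 - t) * x i + t * y i) k) \<le> (\<Sum>k<n. (1 - t) * ?h x k + t * ?h y k)"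
    by (rule sum_mono)
  then have "(\<Sum>k<n. ?h (\<lambda>i. (1 - t) * x i + t * y i) k) / real n \<le> (\<Sum>k<n. (1 - t) * ?h x k + t * ?h y k) / real n"
    by (rule divide_right_mono) simp
  then show "hinge_mean n s c (\<lambda>i. (1 - t) * x i + t * y i) \<le> (1 - t) * hinge_mean n s c x + t * hinge_mean n s c y"
    unfolding hinge_mean_def by (simp only: sum.distrib sum_distrib_left add_divide_distrib times_divide_eq_right)
qed

text \<open>
  The hinge is $1$-Lipschitz, Cauchy--Schwarz passes from the average of $|\lambda_k|$ to that of $\lambda_k^2$,
  and Parseval turns the latter into the Euclidean norm of the row, in which every entry occurs at most twice.
\<close>

lemma hinge_mean_lipschitz:
  assumes n: "n > 0" and s: "s \<ge> 0"
  shows "hinge_mean n s c x - hinge_mean n s c y \<le> s * sqrt 2 * sqrt (\<Sum>j\<in>{1..n div 2 + 1}. (x j - y j)\<^sup>2)"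
proof -
  let ?e = "circ_eig n (\<lambda>i. x i - y i)"
  let ?Q = "\<Sum>j\<in>{1..n div 2 + 1}. (x j - y j)\<^sup>2"
  have "hinge_mean n s c x - hinge_mean n s c y
      = (\<Sum>k<n. max 0 (s * circ_eig n x k - c) - max 0 (s * circ_eig n y k - c)) / real n"
    by (simp add: hinge_mean_def sum_subtractf diff_divide_distrib)
  also have "\<dots> \<le> (\<Sum>k<n. s * \<bar>?e k\<bar>) / real n"
  proof (intro divide_right_mono sum_mono)
    fix k
    have "s * circ_eig n x k - s * circ_eig n y k \<le> s * \<bar>?e k\<bar>"
      using s by (simp add: circ_eig_diff right_diff_distrib[symmetric] mult_left_mono)
    moreover have "0 \<le> s * \<bar>?e k\<bar>" using s by simp
    ultimately show "max 0 (s * circ_eig n x k - c) - max 0 (s * circ_eig n y k - c) \<le> s * \<bar>?e k\<bar>"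
      by linarith
  qed simp
  also have "\<dots> = s * ((\<Sum>k<n. \<bar>?e k\<bar>) / real n)" by (simp add: sum_distrib_left)
  also have "\<dots> \<le> s * sqrt (2 * ?Q)"
  proof (rule mult_left_mono[OF _ s])
    have "(\<Sum>k<n. 1 * \<bar>?e k\<bar>)\<^sup>2 \<le> (\<Sum>k<n. 1\<^sup>2) * (\<Sum>k<n. \<bar>?e k\<bar>\<^sup>2)"
      by (rule Cauchy_Schwarz_ineq_sum)
    also have "\<dots> = real n * (real n * (\<Sum>d<n. (sym_row n (\<lambda>i. x i - y i) (d + 1))\<^sup>2))"
      by (simp add: circ_eig_parseval)
    also have "\<dots> \<le> real n * (real n * (2 * ?Q))"
      by (intro mult_left_mono sum_sym_row_squares_le n) auto
    finally have "((\<Sum>k<n. \<bar>?e k\<bar>) / real n)\<^sup>2 \<le> 2 * ?Q"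
      using n by (simp add: power_divide divide_simps power2_eq_square mult_ac)
    then show "(\<Sum>k<n. \<bar>?e k\<bar>) / real n \<le> sqrt (2 * ?Q)" by (rule real_le_rsqrt)
  qed
  finally show ?thesis by (simp only: real_sqrt_mult mult.assoc)
qed

lemma hinge_mean_measurable:
  assumes "n > 0"
  shows "hinge_mean n s c \<in> borel_measurable (PiM {1..n div 2 + 1} (\<lambda>_. borel))"
proof -
  have [measurable]: "(\<lambda>x. circ_eig n x k) \<in> borel_measurable (PiM {1..n div 2 + 1} (\<lambda>_. borel))" for k
    unfolding circ_eig_coeff[OF assms] by measurable
  show ?thesis unfolding hinge_mean_def[abs_def] by measurable
qed

lemma hinge_mean_restrict:
  assumes "n > 0"
  shows "hinge_mean n s c (restrict x {1..n div 2 + 1}) = hinge_mean n s c x"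
  unfolding hinge_mean_def using circ_eig_cong[OF assms, of "restrict x {1..n div 2 + 1}" x] by simp

definition step_mean :: "nat \<Rightarrow> real \<Rightarrow> real \<Rightarrow> real \<Rightarrow> (nat \<Rightarrow> real) \<Rightarrow> real" where
  "step_mean n s p q x = (\<Sum>k<n. cts_step p q (s * circ_eig n x k)) / real n"

lemma cts_step_hinge: "p < q \<Longrightarrow> cts_step p q u = 1 - (max 0 (u - p) - max 0 (u - q)) / (q - p)"
  by (auto simp: cts_step_def max_def field_simps)

lemma step_mean_hinge:
  assumes "n > 0" "p < q"
  shows "step_mean n s p q x = 1 - (hinge_mean n s p x - hinge_mean n s q x) / (q - p)"
proof -
  have "step_mean n s p q x = (\<Sum>k<n. 1 - (max 0 (s * circ_eig n x k - p) - max 0 (s * circ_eig n x k - q)) / (q - p)) / real n"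
    by (simp only: step_mean_def cts_step_hinge[OF assms(2)])
  also have "\<dots> = (real n - ((\<Sum>k<n. max 0 (s * circ_eig n x k - p)) - (\<Sum>k<n. max 0 (s * circ_eig n x k - q))) / (q - p)) / real n"
    by (simp add: sum_subtractf sum_divide_distrib[symmetric])
  also have "\<dots> = 1 - (hinge_mean n s p x - hinge_mean n s q x) / (q - p)"
    using assms by (simp add: hinge_mean_def diff_divide_distrib mult.commute)
  finally show ?thesis .
qed

lemma cts_step_lipschitz: 
  assumes "p < q" shows "\<bar>cts_step p q u - cts_step p q v\<bar> \<le> \<bar>u - v\<bar> / (q - p)"
proof -
  have "cts_step p q u - cts_step p q v = ((max 0 (v - p) - max 0 (v - q)) - (max 0 (u - p) - max 0 (u - q))) / (q - p)"
    using assms by (simp add: cts_step_hinge diff_divide_distrib)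
  also have "\<bar>\<dots>\<bar> \<le> \<bar>u - v\<bar> / (q - p)"
    unfolding abs_divide using assms by (intro frac_le) (auto simp: max_def)
  finally show ?thesis .
qed

lemma step_mean_perturb:
  assumes n: "n > 0" and pq: "p < q" and s: "s \<ge> 0"
  shows "\<bar>step_mean n s p q x - step_mean n s p q y\<bar> \<le> 2 * s / (q - p) * (\<Sum>j=1..n. \<bar>x j - y j\<bar>)"
proof -
  let ?Q = "\<Sum>j=1..n. \<bar>x j - y j\<bar>"
  have sub: "(\<Sum>j=1..n div 2 + 1. \<bar>x j - y j\<bar>) \<le> ?Q"
    using n by (intro sum_mono2) auto
  have "\<bar>step_mean n s p q x - step_mean n s p q y\<bar>
      = \<bar>\<Sum>k<n. cts_step p q (s * circ_eig n x k) - cts_step p q (s * circ_eig n y k)\<bar> / real n"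
    by (simp add: step_mean_def sum_subtractf diff_divide_distrib[symmetric])
  also have "\<dots> \<le> (\<Sum>k<n. \<bar>cts_step p q (s * circ_eig n x k) - cts_step p q (s * circ_eig n y k)\<bar>) / real n"
    by (intro divide_right_mono sum_abs) simp
  also have "\<dots> \<le> (\<Sum>k<n. 2 * s / (q - p) * ?Q) / real n"
  proof (intro divide_right_mono sum_mono)
    fix k
    have "\<bar>cts_step p q (s * circ_eig n x k) - cts_step p q (s * circ_eig n y k)\<bar>
        \<le> \<bar>s * circ_eig n x k - s * circ_eig n y k\<bar> / (q - p)"
      by (rule cts_step_lipschitz[OF pq])
    also have "\<bar>s * circ_eig n x k - s * circ_eig n y k\<bar> = s * \<bar>circ_eig n x k - circ_eig n y k\<bar>"
      using s by (simp add: right_diff_distrib[symmetric] abs_mult)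
    also have "\<dots> / (q - p) \<le> s * (2 * ?Q) / (q - p)"
      using pq s abs_circ_eig_diff_le[OF n, of x k y] sub
      by (intro divide_right_mono mult_left_mono) auto
    finally show "\<bar>cts_step p q (s * circ_eig n x k) - cts_step p q (s * circ_eig n y k)\<bar> \<le> 2 * s / (q - p) * ?Q"
      by (simp add: mult_ac)
  qed simp
  also have "\<dots> = 2 * s / (q - p) * ?Q" using n by simp
  finally show ?thesis .
qed

lemma cts_step_bounds: "p < q \<Longrightarrow> 0 \<le> cts_step p q u \<and> cts_step p q u \<le> 1"
  by (auto simp: cts_step_def field_simps)

lemma cts_step_measurable [measurable]: "cts_step p q \<in> borel_measurable borel"
  unfolding cts_step_def[abs_def] by measurable

text \<open>
  A step that has reached $0$ at \<open>t\<close> lies below the indicator of the half line up to \<open>t\<close>, and one that starts to fall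
  only after \<open>t\<close> lies above it.
\<close>

lemma step_mean_cdf_bounds:
  fixes x :: "nat \<Rightarrow> real" and n :: nat and s p q t :: real
  defines "F \<equiv> cdf (empirical_spectral_measure (s \<cdot>\<^sub>m sym_circulant n x))"
  assumes "p < q"
  shows "q \<le> t \<Longrightarrow> step_mean n s p q x \<le> F t" and "t \<le> p \<Longrightarrow> F t \<le> step_mean n s p q x"
proof -
  have F: "F t = (\<Sum>k<n. indicator {..t} (s * circ_eig n x k)) / real n"
    by (simp only: F_def cdf_empirical_spectral_measure)
  show "step_mean n s p q x \<le> F t" if "q \<le> t"
    unfolding F step_mean_def using that \<open>p < q\<close>
    by (intro divide_right_mono sum_mono) (auto simp: cts_step_def indicator_def field_simps)
  show "F t \<le> step_mean n s p q x" if "t \<le> p"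
    unfolding F step_mean_def using that \<open>p < q\<close>
    by (intro divide_right_mono sum_mono) (auto simp: cts_step_def indicator_def field_simps)
qed

text \<open>
  The distribution function at \<open>t\<close> is squeezed between a step that falls shortly before \<open>t\<close> and one
  that falls shortly after \<open>t\<close>.
\<close>

lemma weak_conv_if_step_means_converge:
  fixes x :: "nat \<Rightarrow> real" and s :: "nat \<Rightarrow> real"
  assumes N: "real_distribution N"
    and lim: "\<And>p q. p \<in> \<rat> \<Longrightarrow> q \<in> \<rat> \<Longrightarrow> p < q \<Longrightarrow>
      (\<lambda>n. step_mean n (s n) p q x) \<longlonglongrightarrow> (\<integral>u. cts_step p q u \<partial>N)"
  shows "weak_conv_m (\<lambda>n. empirical_spectral_measure (s n \<cdot>\<^sub>m sym_circulant n x)) N"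
  unfolding weak_conv_m_def weak_conv_def
proof (intro allI impI)
  interpret N: real_distribution N by (rule N)
  fix t assume cont: "isCont (cdf N) t"
  let ?F = "\<lambda>n. cdf (empirical_spectral_measure (s n \<cdot>\<^sub>m sym_circulant n x))"
  show "(\<lambda>n. ?F n t) \<longlonglongrightarrow> cdf N t"
  proof (rule tendstoI)
    fix e :: real assume e: "e > 0"
    then obtain d where d: "d > 0" "\<And>u. dist u t < d \<Longrightarrow> dist (cdf N u) (cdf N t) < e"
      using cont unfolding continuous_at_eps_delta dist_norm by (metis real_norm_def)
    obtain p where p: "p \<in> \<rat>" "t - d < p" "p < t" using Rats_dense_in_real[of "t - d" t] d(1) by auto
    obtain q where q: "q \<in> \<rat>" "p < q" "q < t" using Rats_dense_in_real[of p t] p by auto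
    obtain p' where p': "p' \<in> \<rat>" "t < p'" "p' < t + d" using Rats_dense_in_real[of t "t + d"] d(1) by auto
    obtain q' where q': "q' \<in> \<rat>" "p' < q'" "q' < t + d" using Rats_dense_in_real[of p' "t + d"] p' by auto
    have "cdf N t - e < cdf N p"
      using d(2)[of p] p by (auto simp: dist_real_def)
    also have "\<dots> \<le> (\<integral>u. cts_step p q u \<partial>N)" by (rule N.cdf_cts_step[OF q(2)])
    finally have low: "eventually (\<lambda>n. cdf N t - e < step_mean n (s n) p q x) sequentially"
      by (rule order_tendstoD(1)[OF lim[OF p(1) q(1,2)]])
    have "(\<integral>u. cts_step p' q' u \<partial>N) \<le> cdf N q'" by (rule N.cdf_cts_step[OF q'(2)])
    also have "\<dots> < cdf N t + e"
      using d(2)[of q'] q' p' by (auto simp: dist_real_def)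
    finally have "eventually (\<lambda>n. step_mean n (s n) p' q' x < cdf N t + e) sequentially"
      by (rule order_tendstoD(2)[OF lim[OF p'(1) q'(1,2)]])
    with low show "eventually (\<lambda>n. dist (?F n t) (cdf N t) < e) sequentially"
    proof eventually_elim
      case (elim n)
      have "step_mean n (s n) p q x \<le> ?F n t" "?F n t \<le> step_mean n (s n) p' q' x"
        using step_mean_cdf_bounds[OF q(2)] step_mean_cdf_bounds[OF q'(2)] q p' by simp_all
      then show ?case using elim by (auto simp: dist_real_def)
    qed
  qed
qed

section \<open>Truncation and almost sure convergence\<close>

text \<open>
  The exponent may be any number strictly between $1/3$ and $1/2$: above $1/3$ the third moments
  make the exceedance probabilities summable, below $1/2$ the cut-off entries are small enough for
  concentration at the scale $\sqrt n$.
\<close>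

definition cutoff :: "nat \<Rightarrow> real \<Rightarrow> real" where
  "cutoff j x = (if \<bar>x\<bar> \<le> real j powr (2/5) then x else 0)"

lemma cutoff_measurable [measurable]: "cutoff j \<in> borel_measurable borel"
  unfolding cutoff_def[abs_def] by measurable

lemma abs_cutoff_le: "\<bar>cutoff j x\<bar> \<le> real j powr (2/5)"
  by (simp add: cutoff_def)

text \<open>
  Beyond the cut-off, $1 \le (|x|/j^{2/5})^2$.
\<close>

lemma cutoff_error_le:
  assumes "j \<ge> 1"
  shows "\<bar>x - cutoff j x\<bar> \<le> \<bar>x\<bar> ^ 3 * real j powr (-4/5)"
proof (cases "\<bar>x\<bar> \<le> real j powr (2/5)")
  case False
  define h where "h = real j powr (2/5)"
  have h: "h > 0" "\<bar>x\<bar> > h" using assms False by (simp_all add: h_def)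
  have "h\<^sup>2 * (real j powr (-4/5)) = 1"
    using assms by (simp add: h_def power2_eq_square powr_add[symmetric])
  moreover have "h\<^sup>2 \<le> \<bar>x\<bar>\<^sup>2" using h by (intro power_mono) auto
  ultimately have "1 \<le> \<bar>x\<bar>\<^sup>2 * real j powr (-4/5)"
    by (metis mult_right_mono powr_ge_zero)
  then have "\<bar>x\<bar> * 1 \<le> \<bar>x\<bar> * (\<bar>x\<bar>\<^sup>2 * real j powr (-4/5))" by (rule mult_left_mono) simp
  then show ?thesis using False by (simp add: cutoff_def power3_eq_cube power2_eq_square mult_ac)
qed (simp add: cutoff_def)

lemma sum_le_initial_segment:
  fixes g :: "nat \<Rightarrow> real"
  assumes "\<And>j. g j \<ge> 0" "\<And>j. j \<ge> J \<Longrightarrow> g j = 0"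
  shows "(\<Sum>j=1..n. g j) \<le> (\<Sum>j<J. g j)"
proof -
  have "(\<Sum>j=1..n. g j) = (\<Sum>j\<in>{1..n} \<inter> {..<J}. g j)"
  proof (intro sum.mono_neutral_right ballI)
    fix j assume "j \<in> {1..n} - {1..n} \<inter> {..<J}"
    then have "j \<ge> J" by auto
    then show "g j = 0" by (rule assms(2))
  qed auto
  also have "\<dots> \<le> (\<Sum>j<J. g j)" using assms by (intro sum_mono2) auto
  finally show ?thesis .
qed

context prob_space
begin

text \<open>
  By Markov's inequality $X_j$ exceeds its cut-off with probability at most $C j^{-6/5}$, so almost surely
  this happens for finitely many $j$ only.
\<close>

lemma cutoff_error_bounded_AE:
  assumes X: "\<And>j. j \<ge> 1 \<Longrightarrow> random_variable borel (X j)"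
    and int3: "\<And>j. j \<ge> 1 \<Longrightarrow> integrable M (\<lambda>\<omega>. \<bar>X j \<omega>\<bar> ^ 3)"
    and C: "\<And>j. j \<ge> 1 \<Longrightarrow> expectation (\<lambda>\<omega>. \<bar>X j \<omega>\<bar> ^ 3) \<le> C"
  shows "AE \<omega> in M. \<exists>B. \<forall>n. (\<Sum>j=1..n. \<bar>X j \<omega> - cutoff j (X j \<omega>)\<bar>) \<le> B"
proof -
  define A where "A j = {\<omega>\<in>space M. j \<ge> 1 \<and> \<bar>X j \<omega>\<bar> > real j powr (2/5)}" for j
  have meas: "A j \<in> sets M" for j
    using X[of j] by (cases "j \<ge> 1") (simp_all add: A_def)
  have prob_le: "prob (A j) \<le> C * real j powr (-6/5)" if j: "j \<ge> 1" for j
  proof -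
    have "prob (A j) \<le> prob {\<omega>\<in>space M. real j powr (6/5) \<le> \<bar>X j \<omega>\<bar> ^ 3}"
    proof (rule finite_measure_mono)
      show "A j \<subseteq> {\<omega>\<in>space M. real j powr (6/5) \<le> \<bar>X j \<omega>\<bar> ^ 3}"
      proof
        fix \<omega> assume "\<omega> \<in> A j"
        then have \<omega>: "\<omega> \<in> space M" "real j powr (2/5) \<le> \<bar>X j \<omega>\<bar>" by (auto simp: A_def)
        have "real j powr (6/5) = (real j powr (2/5)) ^ 3"
          using j by (simp add: power3_eq_cube powr_add[symmetric])
        also have "\<dots> \<le> \<bar>X j \<omega>\<bar> ^ 3" by (rule power_mono[OF \<omega>(2)]) simp
        finally show "\<omega> \<in> {\<omega>\<in>space M. real j powr (6/5) \<le> \<bar>X j \<omega>\<bar> ^ 3}" using \<omega>(1) by simp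
      qed
      show "{\<omega>\<in>space M. real j powr (6/5) \<le> \<bar>X j \<omega>\<bar> ^ 3} \<in> sets M"
        using X[OF j] by measurable
    qed
    also have "\<dots> \<le> expectation (\<lambda>\<omega>. \<bar>X j \<omega>\<bar> ^ 3) / real j powr (6/5)"
      using j by (intro integral_Markov_inequality_measure[OF int3[OF j] sets.empty_sets]) auto
    also have "\<dots> \<le> C / real j powr (6/5)" by (intro divide_right_mono C j) simp
    also have "\<dots> = C * real j powr (-6/5)" using powr_minus_divide[of "real j" "6/5"] by simp
    finally show ?thesis .
  qed
  have "summable (\<lambda>j. prob (A j))"
  proof (rule summable_comparison_test_ev)
    show "eventually (\<lambda>j. norm (prob (A j)) \<le> C * real j powr (-6/5)) sequentially"
      using eventually_ge_at_top[of 1]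
    proof eventually_elim
      case (elim j)
      show ?case using prob_le[OF elim] by simp
    qed
    show "summable (\<lambda>j. C * real j powr (-6/5))"
      by (intro summable_mult) (simp add: summable_real_powr_iff)
  qed
  then have "AE \<omega> in M. eventually (\<lambda>j. \<omega> \<in> space M - A j) sequentially"
    using meas by (intro borel_cantelli_AE1) (auto simp: emeasure_eq_measure)
  then show ?thesis
  proof eventually_elim
    case (elim \<omega>)
    then obtain J where J: "\<And>j. j \<ge> J \<Longrightarrow> \<omega> \<in> space M - A j" by (auto simp: eventually_sequentially)
    have "\<bar>X j \<omega> - cutoff j (X j \<omega>)\<bar> = 0" if "j \<ge> Suc J" for j
      using J[of j] that by (auto simp: A_def cutoff_def)
    then have "(\<Sum>j=1..n. \<bar>X j \<omega> - cutoff j (X j \<omega>)\<bar>) \<le> (\<Sum>j<Suc J. \<bar>X j \<omega> - cutoff j (X j \<omega>)\<bar>)" for n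
      by (intro sum_le_initial_segment) auto
    then show ?case by blast
  qed
qed

lemma expectation_cutoff_error_le:
  assumes j: "j \<ge> 1" and X[measurable]: "random_variable borel X"
    and int3: "integrable M (\<lambda>\<omega>. \<bar>X \<omega>\<bar> ^ 3)" and C: "expectation (\<lambda>\<omega>. \<bar>X \<omega>\<bar> ^ 3) \<le> C"
  shows "integrable M (\<lambda>\<omega>. \<bar>X \<omega> - cutoff j (X \<omega>)\<bar>)"
    and "expectation (\<lambda>\<omega>. \<bar>X \<omega> - cutoff j (X \<omega>)\<bar>) \<le> C * real j powr (-4/5)"
proof -
  show int: "integrable M (\<lambda>\<omega>. \<bar>X \<omega> - cutoff j (X \<omega>)\<bar>)"
  proof (rule Bochner_Integration.integrable_bound)
    show "integrable M (\<lambda>\<omega>. \<bar>X \<omega>\<bar> ^ 3 * real j powr (-4/5))" using int3 by simp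
    show "AE \<omega> in M. norm \<bar>X \<omega> - cutoff j (X \<omega>)\<bar> \<le> norm (\<bar>X \<omega>\<bar> ^ 3 * real j powr (-4/5))"
      using cutoff_error_le[OF j] by (intro AE_I2) (simp add: abs_mult)
  qed measurable
  have "expectation (\<lambda>\<omega>. \<bar>X \<omega> - cutoff j (X \<omega>)\<bar>) \<le> expectation (\<lambda>\<omega>. \<bar>X \<omega>\<bar> ^ 3 * real j powr (-4/5))"
    using int int3 cutoff_error_le[OF j] by (intro integral_mono) auto
  also have "\<dots> \<le> C * real j powr (-4/5)" using C by (simp add: mult_right_mono)
  finally show "expectation (\<lambda>\<omega>. \<bar>X \<omega> - cutoff j (X \<omega>)\<bar>) \<le> C * real j powr (-4/5)" .
qed

text \<open>
  The Lipschitz constant is $\sqrt 2/(\sigma\sqrt n)$ and the cut-off entries lie in an interval of length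
  $2n^{2/5}$, which leaves $n^{1-4/5}$ in the exponent.
\<close>

lemma hinge_mean_cutoff_concentration:
  fixes X :: "nat \<Rightarrow> 'a \<Rightarrow> real" and c \<sigma> :: real
  assumes indep: "indep_vars (\<lambda>_. borel) X {1..}" and n: "n > 0" and \<sigma>: "\<sigma> > 0" and \<epsilon>: "\<epsilon> > 0"
  defines "H \<equiv> \<lambda>\<omega>. hinge_mean n (1 / (\<sigma> * sqrt (real n))) c (\<lambda>j. cutoff j (X j \<omega>))"
  shows "prob {\<omega>\<in>space M. \<epsilon> \<le> \<bar>H \<omega> - expectation H\<bar>} \<le> 2 * exp (- (\<epsilon>\<^sup>2 * \<sigma>\<^sup>2 / 32 * real n powr (1/5)))"
proof -
  let ?s = "1 / (\<sigma> * sqrt (real n))" and ?I = "{1..n div 2 + 1}"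
  define b where "b = real n powr (2/5)"
  have b: "b > 0" using n by (simp add: b_def)
  have s: "?s > 0" using n \<sigma> by simp
  have "prob {\<omega>\<in>space M. \<epsilon> \<le> \<bar>hinge_mean n ?s c (\<lambda>i\<in>?I. cutoff i (X i \<omega>))
        - expectation (\<lambda>\<omega>. hinge_mean n ?s c (\<lambda>i\<in>?I. cutoff i (X i \<omega>)))\<bar>}
      \<le> 2 * exp (- \<epsilon>\<^sup>2 / (4 * (?s * sqrt 2 * (b - (- b)))\<^sup>2))"
  proof (rule convex_concentration)
    show "indep_vars (\<lambda>_. borel) (\<lambda>i \<omega>. cutoff i (X i \<omega>)) ?I"
      by (rule indep_vars_compose2[OF indep_vars_subset[OF indep]]) auto
    fix i \<omega> assume i: "i \<in> ?I"
    have "real i powr (2/5) \<le> b"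
      using i n unfolding b_def by (intro powr_mono2) auto
    then show "cutoff i (X i \<omega>) \<in> {- b..b}"
      using abs_cutoff_le[of i "X i \<omega>"] by auto
  next
    fix x y :: "nat \<Rightarrow> real"
    show "hinge_mean n ?s c x - hinge_mean n ?s c y \<le> ?s * sqrt 2 * sqrt (\<Sum>i\<in>?I. (x i - y i)\<^sup>2)"
      using s by (intro hinge_mean_lipschitz n) auto
  qed (use b s \<epsilon> hinge_mean_convex hinge_mean_measurable[OF n] in auto)
  also have "(?s * sqrt 2 * (b - (- b)))\<^sup>2 = 8 / \<sigma>\<^sup>2 * (b\<^sup>2 / real n)"
    using n by (simp add: power_mult_distrib power_divide)
  also have "b\<^sup>2 / real n = 1 / real n powr (1/5)"
  proof -
    have "b\<^sup>2 * real n powr (1/5) = real n powr (4/5) * real n powr (1/5)"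
      by (simp add: b_def power2_eq_square powr_add[symmetric])
    also have "\<dots> = real n" using n by (simp only: powr_add[symmetric]) simp
    finally show ?thesis using n by (simp add: field_simps)
  qed
  also have "- \<epsilon>\<^sup>2 / (4 * (8 / \<sigma>\<^sup>2 * (1 / real n powr (1/5)))) = - (\<epsilon>\<^sup>2 * \<sigma>\<^sup>2 / 32 * real n powr (1/5))"
    using \<sigma> n by simp
  finally show ?thesis
    unfolding H_def hinge_mean_restrict[OF n] .
qed

lemma hinge_mean_cutoff_AE:
  fixes X :: "nat \<Rightarrow> 'a \<Rightarrow> real" and c \<sigma> :: real
  assumes indep: "indep_vars (\<lambda>_. borel) X {1..}" and \<sigma>: "\<sigma> > 0"
  defines "H \<equiv> \<lambda>n \<omega>. hinge_mean n (1 / (\<sigma> * sqrt (real n))) c (\<lambda>j. cutoff j (X j \<omega>))"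
  shows "AE \<omega> in M. (\<lambda>n. H n \<omega> - expectation (H n)) \<longlonglongrightarrow> 0"
proof -
  have rv [measurable]: "random_variable borel (X j)" if "j \<ge> 1" for j
    using indep that by (auto simp: indep_vars_def2)
  have [measurable]: "H n \<in> borel_measurable M" for n
  proof (cases "n = 0")
    case False
    then show ?thesis
      unfolding H_def hinge_mean_def by (simp only: circ_eig_coeff neq0_conv) measurable
  qed (simp add: H_def hinge_mean_def)
  have "AE \<omega> in M. \<forall>m::nat. eventually (\<lambda>n. \<bar>H n \<omega> - expectation (H n)\<bar> < 1 / real (Suc m)) sequentially"
    unfolding AE_all_countable
  proof
    fix m :: nat
    define \<epsilon> where "\<epsilon> = 1 / real (Suc m)"
    define r where "r = \<epsilon>\<^sup>2 * \<sigma>\<^sup>2 / 32"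
    have \<epsilon>: "\<epsilon> > 0" by (simp add: \<epsilon>_def)
    then have r: "r > 0" using \<sigma> by (simp add: r_def)
    let ?A = "\<lambda>n. {\<omega>\<in>space M. \<epsilon> \<le> \<bar>H n \<omega> - expectation (H n)\<bar>}"
    have "summable (\<lambda>n. prob (?A n))"
    proof (rule summable_comparison_test_ev)
      have "eventually (\<lambda>n. 2 * exp (- (r * real n powr (1/5))) \<le> 1 / real n ^ 2) sequentially"
        using r by real_asymp
      then show "eventually (\<lambda>n. norm (prob (?A n)) \<le> 1 / real n ^ 2) sequentially"
        using eventually_gt_at_top[of 0]
      proof eventually_elim
        case (elim n)
        have "prob (?A n) \<le> 2 * exp (- (r * real n powr (1/5)))"
          unfolding H_def r_def by (rule hinge_mean_cutoff_concentration[OF indep elim(2) \<sigma> \<epsilon>])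
        then show ?case using elim(1) by simp
      qed
      show "summable (\<lambda>n. 1 / real n ^ 2)"
        using inverse_power_summable[of 2, where 'a = real] by (simp add: inverse_eq_divide)
    qed
    then have "AE \<omega> in M. eventually (\<lambda>n. \<omega> \<in> space M - ?A n) sequentially"
      by (intro borel_cantelli_AE1) (auto simp: emeasure_eq_measure)
    then show "AE \<omega> in M. eventually (\<lambda>n. \<bar>H n \<omega> - expectation (H n)\<bar> < 1 / real (Suc m)) sequentially"
      by eventually_elim (auto simp: \<epsilon>_def elim!: eventually_mono)
  qed
  then show ?thesis
  proof eventually_elim
    case (elim \<omega>)
    show ?case
    proof (rule tendstoI)
      fix e :: real assume "e > 0"
      then obtain m where "1 / real (Suc m) < e" using nat_approx_posE by blast
      with elim show "eventually (\<lambda>n. dist (H n \<omega> - expectation (H n)) 0 < e) sequentially"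
        by (auto elim!: allE[of _ m] eventually_mono)
    qed
  qed
qed

text \<open>
  For every \<open>n\<close> the worst admissible frequency is selected and the central limit theorem is applied
  along this sequence of frequencies. It then bounds the error at all admissible frequencies at once.
\<close>

lemma step_mean_expectation_limit:
  fixes X :: "nat \<Rightarrow> 'a \<Rightarrow> real"
  assumes indep: "indep_vars (\<lambda>_. borel) X {1..}"
    and int3: "\<And>j. j \<ge> 1 \<Longrightarrow> integrable M (\<lambda>\<omega>. \<bar>X j \<omega>\<bar> ^ 3)"
    and int2: "\<And>j. j \<ge> 1 \<Longrightarrow> integrable M (\<lambda>\<omega>. (X j \<omega>)\<^sup>2)" and int1: "\<And>j. j \<ge> 1 \<Longrightarrow> integrable M (X j)"
    and mean: "\<And>j. j \<ge> 1 \<Longrightarrow> expectation (X j) = m"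
    and var: "\<And>j. j \<ge> 1 \<Longrightarrow> variance (X j) = \<sigma>\<^sup>2"
    and C: "\<And>j. j \<ge> 1 \<Longrightarrow> expectation (\<lambda>\<omega>. \<bar>X j \<omega>\<bar> ^ 3) \<le> C" and \<sigma>: "\<sigma> > 0" and pq: "p < q"
  shows "(\<lambda>n. expectation (\<lambda>\<omega>. step_mean n (1 / (\<sigma> * sqrt (real n))) p q (\<lambda>j. X j \<omega>)))
     \<longlonglongrightarrow> (\<integral>x. cts_step p q x \<partial>std_normal_distribution)"
proof -
  have rv: "random_variable borel (X j)" if "j \<ge> 1" for j
    using indep that by (auto simp: indep_vars_def2)
  interpret N: real_distribution std_normal_distribution by (rule real_dist_normal_dist)
  define \<gamma> where "\<gamma> = (\<integral>x. cts_step p q x \<partial>std_normal_distribution)"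
  define s where "s n = 1 / (\<sigma> * sqrt (real n))" for n
  define E where "E n k = expectation (\<lambda>\<omega>. cts_step p q (s n * circ_eig n (\<lambda>j. X j \<omega>) k)) - \<gamma>" for n k
  have eig_meas [measurable]: "random_variable borel (\<lambda>\<omega>. circ_eig n (\<lambda>j. X j \<omega>) k)" for n k
    by (rule circ_eig_random_variable[OF rv])
  have int_step: "integrable M (\<lambda>\<omega>. cts_step p q (s n * circ_eig n (\<lambda>j. X j \<omega>) k))" for n k
    using cts_step_bounds[OF pq] by (intro integrable_const_bound[where B = 1] AE_I2) auto
  have \<gamma>: "0 \<le> \<gamma>" "\<gamma> \<le> 1"
    using N.cdf_cts_step[OF pq] N.cdf_nonneg[of p] N.cdf_bounded_prob[of q]
    unfolding \<gamma>_def by linarith+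
  have E1: "\<bar>E n k\<bar> \<le> 1" for n k
  proof -
    have "0 \<le> expectation (\<lambda>\<omega>. cts_step p q (s n * circ_eig n (\<lambda>j. X j \<omega>) k))"
      using cts_step_bounds[OF pq] by (intro integral_nonneg_AE AE_I2) auto
    moreover have "expectation (\<lambda>\<omega>. cts_step p q (s n * circ_eig n (\<lambda>j. X j \<omega>) k)) \<le> 1"
      using cts_step_bounds[OF pq] by (intro integral_le_const int_step AE_I2) auto
    ultimately show ?thesis using \<gamma> by (simp add: E_def)
  qed
  \<comment> \<open>For \<open>n \<ge> 3\<close> the frequency \<open>k = 1\<close> is admissible, so a worst one exists.\<close>
  have "\<exists>\<kappa>. n \<ge> 3 \<longrightarrow> \<not> n dvd 2 * \<kappa> \<and> (\<forall>k<n. \<not> n dvd 2 * k \<longrightarrow> \<bar>E n k\<bar> \<le> \<bar>E n \<kappa>\<bar>)" for n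
  proof (cases "n \<ge> 3")
    case True
    let ?G = "{k. k < n \<and> \<not> n dvd 2 * k}"
    have "\<not> n dvd 2 * 1" using True by (auto dest: dvd_imp_le)
    then have "?G \<noteq> {}" using True by (auto intro!: exI[of _ 1])
    moreover have "finite ?G" by simp
    ultimately have "Max ((\<lambda>k. \<bar>E n k\<bar>) ` ?G) \<in> (\<lambda>k. \<bar>E n k\<bar>) ` ?G" by (intro Max_in) auto
    then obtain \<kappa> where \<kappa>: "\<kappa> \<in> ?G" "Max ((\<lambda>k. \<bar>E n k\<bar>) ` ?G) = \<bar>E n \<kappa>\<bar>" by blast
    have "\<bar>E n k\<bar> \<le> \<bar>E n \<kappa>\<bar>" if "k \<in> ?G" for k
      unfolding \<kappa>(2)[symmetric] using that by (intro Max_ge) auto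
    with \<kappa>(1) show ?thesis by blast
  qed blast
  then obtain \<kappa> where \<kappa>: "\<And>n. n \<ge> 3 \<Longrightarrow> \<not> n dvd 2 * \<kappa> n"
    "\<And>n k. n \<ge> 3 \<Longrightarrow> k < n \<Longrightarrow> \<not> n dvd 2 * k \<Longrightarrow> \<bar>E n k\<bar> \<le> \<bar>E n (\<kappa> n)\<bar>"
    by metis
  have "weak_conv_m (\<lambda>n. distr M borel (\<lambda>\<omega>. 1 / (\<sigma> * sqrt (real n)) * circ_eig n (\<lambda>j. X j \<omega> - m) (\<kappa> n)))
     std_normal_distribution"
  proof (rule circ_eig_clt[where C = "8 * (C + \<bar>m\<bar> ^ 3)"])
    show "indep_vars (\<lambda>_. borel) (\<lambda>j \<omega>. X j \<omega> - m) {1..}"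
      by (rule indep_vars_compose2[OF indep]) auto
    show "eventually (\<lambda>n. \<not> n dvd 2 * \<kappa> n) sequentially"
      using eventually_ge_at_top[of 3] by eventually_elim (rule \<kappa>(1))
    fix j :: nat assume j: "j \<ge> 1"
    show "integrable M (\<lambda>\<omega>. \<bar>X j \<omega> - m\<bar> ^ 3)" "expectation (\<lambda>\<omega>. \<bar>X j \<omega> - m\<bar> ^ 3) \<le> 8 * (C + \<bar>m\<bar> ^ 3)"
      using third_moment_centered[OF rv[OF j] int3[OF j] C[OF j]] by simp_all
    show "integrable M (\<lambda>\<omega>. X j \<omega> - m)" using int1[OF j] by simp
    show "expectation (\<lambda>\<omega>. X j \<omega> - m) = 0" using int1[OF j] mean[OF j] by (simp add: prob_space)
    show "expectation (\<lambda>\<omega>. (X j \<omega> - m)\<^sup>2) = \<sigma>\<^sup>2" using var[OF j] mean[OF j] by simp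
    show "integrable M (\<lambda>\<omega>. (X j \<omega> - m)\<^sup>2)"
      unfolding power2_diff using int1[OF j] int2[OF j] by simp
  qed (rule \<sigma>)
  then have "(\<lambda>n. \<integral>x. cts_step p q x \<partial>distr M borel (\<lambda>\<omega>. 1 / (\<sigma> * sqrt (real n)) * circ_eig n (\<lambda>j. X j \<omega> - m) (\<kappa> n))) \<longlonglongrightarrow> \<gamma>"
    unfolding \<gamma>_def
  proof (rule weak_conv_imp_integral_bdd_continuous_conv[rotated 2])
    show "isCont (cts_step p q) x" for x
      using uniformly_continuous_imp_continuous[OF cts_step_uniformly_continuous[OF pq]]
      by (simp add: continuous_on_eq_continuous_at)
    show "norm (cts_step p q x) \<le> 1" for x using cts_step_bounds[OF pq, of x] by simp
    show "real_distribution std_normal_distribution" by (rule real_dist_normal_dist)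
    show "real_distribution (distr M borel (\<lambda>\<omega>. 1 / (\<sigma> * sqrt (real n)) * circ_eig n (\<lambda>j. X j \<omega> - m) (\<kappa> n)))" for n
      using rv by (intro real_distribution_distr borel_measurable_times borel_measurable_const circ_eig_random_variable borel_measurable_diff) auto
  qed
  then have "(\<lambda>n. (\<integral>x. cts_step p q x \<partial>distr M borel (\<lambda>\<omega>. 1 / (\<sigma> * sqrt (real n)) * circ_eig n (\<lambda>j. X j \<omega> - m) (\<kappa> n))) - \<gamma>) \<longlonglongrightarrow> 0"
    by (rule LIM_zero)
  moreover have "eventually (\<lambda>n. (\<integral>x. cts_step p q x \<partial>distr M borel (\<lambda>\<omega>. 1 / (\<sigma> * sqrt (real n)) * circ_eig n (\<lambda>j. X j \<omega> - m) (\<kappa> n))) - \<gamma>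
       = E n (\<kappa> n)) sequentially"
    using eventually_ge_at_top[of 3]
  proof eventually_elim
    case (elim n)
    have n: "n > 0" "\<not> n dvd \<kappa> n" using elim \<kappa>(1)[OF elim] by auto
    show ?case
      unfolding circ_eig_shift[OF n] E_def s_def by (subst integral_distr) auto
  qed
  ultimately have E0: "(\<lambda>n. E n (\<kappa> n)) \<longlonglongrightarrow> 0"
    by (rule Lim_transform_eventually)
  have "(\<lambda>n. expectation (\<lambda>\<omega>. step_mean n (s n) p q (\<lambda>j. X j \<omega>)) - \<gamma>) \<longlonglongrightarrow> 0"
  proof (rule Lim_null_comparison)
    show "(\<lambda>n. 2 / real n + \<bar>E n (\<kappa> n)\<bar>) \<longlonglongrightarrow> 0"
      using tendsto_add[OF lim_const_over_n[of 2] tendsto_rabs_zero[OF E0]] by simp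
    show "eventually (\<lambda>n. norm (expectation (\<lambda>\<omega>. step_mean n (s n) p q (\<lambda>j. X j \<omega>)) - \<gamma>)
       \<le> 2 / real n + \<bar>E n (\<kappa> n)\<bar>) sequentially"
      using eventually_ge_at_top[of 3]
    proof eventually_elim
      case (elim n)
      let ?bad = "{k. k < n \<and> n dvd 2 * k}"
      have n: "n > 0" using elim by simp
      have "expectation (\<lambda>\<omega>. step_mean n (s n) p q (\<lambda>j. X j \<omega>)) - \<gamma>
          = (\<Sum>k<n. expectation (\<lambda>\<omega>. cts_step p q (s n * circ_eig n (\<lambda>j. X j \<omega>) k))) / real n - \<gamma>"
        unfolding step_mean_def using int_step by simp
      also have "\<dots> = (\<Sum>k<n. E n k) / real n"
        using n by (simp add: E_def sum_subtractf diff_divide_distrib)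
      finally have eq: "expectation (\<lambda>\<omega>. step_mean n (s n) p q (\<lambda>j. X j \<omega>)) - \<gamma> = (\<Sum>k<n. E n k) / real n" .
      have "\<bar>\<Sum>k<n. E n k\<bar> \<le> (\<Sum>k<n. \<bar>E n k\<bar>)" by (rule sum_abs)
      also have "\<dots> \<le> (\<Sum>k<n. (if n dvd 2 * k then 1 else 0) + \<bar>E n (\<kappa> n)\<bar>)"
      proof (rule sum_mono)
        fix k assume "k \<in> {..<n}"
        then show "\<bar>E n k\<bar> \<le> (if n dvd 2 * k then 1 else 0) + \<bar>E n (\<kappa> n)\<bar>"
          using E1[of n k] \<kappa>(2)[OF elim, of k] by (auto intro: order_trans)
      qed
      also have "\<dots> = real (card ?bad) + real n * \<bar>E n (\<kappa> n)\<bar>"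
      proof -
        have "(\<Sum>k<n. if n dvd 2 * k then 1 else 0 :: real) = (\<Sum>k\<in>{k\<in>{..<n}. n dvd 2 * k}. 1)"
          by (rule sum.inter_filter[symmetric]) simp
        then show ?thesis by (simp add: sum.distrib)
      qed
      also have "\<dots> \<le> 2 + real n * \<bar>E n (\<kappa> n)\<bar>"
        using card_double_multiples_le[of n] by simp
      finally have "\<bar>\<Sum>k<n. E n k\<bar> / real n \<le> (2 + real n * \<bar>E n (\<kappa> n)\<bar>) / real n"
        by (rule divide_right_mono) simp
      then show ?case unfolding eq using n by (simp add: add_divide_distrib)
    qed
  qed
  then show ?thesis unfolding s_def \<gamma>_def by (rule LIM_zero_cancel)
qed

lemma hinge_mean_integrable:
  fixes Y :: "nat \<Rightarrow> 'a \<Rightarrow> real"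
  assumes Y: "\<And>j. j \<ge> 1 \<Longrightarrow> integrable M (Y j)" and n: "n > 0"
  shows "integrable M (\<lambda>\<omega>. hinge_mean n s c (\<lambda>j. Y j \<omega>))"
proof -
  have eig: "integrable M (\<lambda>\<omega>. circ_eig n (\<lambda>j. Y j \<omega>) k)" for k
    unfolding circ_eig_coeff[OF n] using Y by (intro Bochner_Integration.integrable_sum integrable_mult_right) auto
  show ?thesis
    unfolding hinge_mean_def
    by (intro Bochner_Integration.integrable_sum integrable_divide integrable_max eig
        Bochner_Integration.integrable_diff integrable_mult_right) auto
qed

text \<open>
  The difference to the limit is split into the effect of the cut-off on the path, the deviation of the cut-off
  statistic from its mean, the effect of the cut-off on the mean, and the convergence of the mean without
  cut-off. The deviation is controlled through the two hinges that make up the step.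
\<close>

lemma step_mean_AE:
  fixes X :: "nat \<Rightarrow> 'a \<Rightarrow> real"
  assumes indep: "indep_vars (\<lambda>_. borel) X {1..}"
    and int3: "\<And>j. j \<ge> 1 \<Longrightarrow> integrable M (\<lambda>\<omega>. \<bar>X j \<omega>\<bar> ^ 3)"
    and int2: "\<And>j. j \<ge> 1 \<Longrightarrow> integrable M (\<lambda>\<omega>. (X j \<omega>)\<^sup>2)" and int1: "\<And>j. j \<ge> 1 \<Longrightarrow> integrable M (X j)"
    and mean: "\<And>j. j \<ge> 1 \<Longrightarrow> expectation (X j) = m"
    and var: "\<And>j. j \<ge> 1 \<Longrightarrow> variance (X j) = \<sigma>\<^sup>2"
    and C: "\<And>j. j \<ge> 1 \<Longrightarrow> expectation (\<lambda>\<omega>. \<bar>X j \<omega>\<bar> ^ 3) \<le> C" and \<sigma>: "\<sigma> > 0" and pq: "p < q"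
  shows "AE \<omega> in M. (\<lambda>n. step_mean n (1 / (\<sigma> * sqrt (real n))) p q (\<lambda>j. X j \<omega>))
     \<longlonglongrightarrow> (\<integral>x. cts_step p q x \<partial>std_normal_distribution)"
proof -
  define \<gamma> where "\<gamma> = (\<integral>x. cts_step p q x \<partial>std_normal_distribution)"
  define s where "s n = 1 / (\<sigma> * sqrt (real n))" for n
  define Y where "Y j \<omega> = cutoff j (X j \<omega>)" for j \<omega>
  define SX where "SX n \<omega> = step_mean n (s n) p q (\<lambda>j. X j \<omega>)" for n \<omega>
  define SY where "SY n \<omega> = step_mean n (s n) p q (\<lambda>j. Y j \<omega>)" for n \<omega>
  define H where "H n c \<omega> = hinge_mean n (s n) c (\<lambda>j. Y j \<omega>)" for n c \<omega>
  define c where "c = 2 / (\<sigma> * (q - p))"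
  have c: "c > 0" using \<sigma> pq by (simp add: c_def)
  have s: "s n \<ge> 0" for n using \<sigma> by (simp add: s_def)
  have rv: "random_variable borel (X j)" if "j \<ge> 1" for j
    using indep that by (auto simp: indep_vars_def2)
  have rvY: "random_variable borel (Y j)" if "j \<ge> 1" for j
    unfolding Y_def[abs_def] using rv[OF that] by measurable
  have intY: "integrable M (Y j)" if "j \<ge> 1" for j
    using rvY[OF that] abs_cutoff_le by (intro integrable_const_bound[where B = "real j powr (2/5)"]) (auto simp: Y_def)
  have SX_int: "integrable M (SX n)" and SY_int: "integrable M (SY n)" for n
  proof -
    have "integrable M (\<lambda>\<omega>. step_mean n (s n) p q (\<lambda>j. W j \<omega>))"
      if W: "\<And>j. j \<ge> 1 \<Longrightarrow> random_variable borel (W j)" for W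
    proof -
      have [measurable]: "random_variable borel (\<lambda>\<omega>. circ_eig n (\<lambda>j. W j \<omega>) k)" for k
        by (rule circ_eig_random_variable[OF W])
      have "integrable M (\<lambda>\<omega>. cts_step p q (s n * circ_eig n (\<lambda>j. W j \<omega>) k))" for k
        using cts_step_bounds[OF pq] by (intro integrable_const_bound[where B = 1] AE_I2) auto
      then show ?thesis unfolding step_mean_def by simp
    qed
    from this[OF rv] this[OF rvY] show "integrable M (SX n)" "integrable M (SY n)"
      by (simp_all add: SX_def[abs_def] SY_def[abs_def])
  qed
  have perturb: "\<bar>SX n \<omega> - SY n \<omega>\<bar> \<le> c / sqrt (real n) * (\<Sum>j=1..n. \<bar>X j \<omega> - Y j \<omega>\<bar>)" if "n > 0" for n \<omega>
    using step_mean_perturb[OF that pq s, of n "\<lambda>j. X j \<omega>" "\<lambda>j. Y j \<omega>"]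
    by (simp add: SX_def SY_def s_def c_def mult_ac)
  have mean_diff: "(\<lambda>n. expectation (SX n) - expectation (SY n)) \<longlonglongrightarrow> 0"
  proof (rule Lim_null_comparison)
    define K where "K = (\<Sum>j. real j powr (-6/5))"
    have sm: "summable (\<lambda>j. real j powr (-6/5))" by (simp add: summable_real_powr_iff)
    have C0: "0 \<le> C" using C[of 1] by (auto intro: order_trans[rotated] integral_nonneg_AE)
    show "eventually (\<lambda>n. norm (expectation (SX n) - expectation (SY n))
        \<le> c / sqrt (real n) * (real n powr (2/5) * (C * K))) sequentially"
      using eventually_gt_at_top[of 0]
    proof eventually_elim
      case (elim n)
      have int: "integrable M (\<lambda>\<omega>. \<bar>X j \<omega> - Y j \<omega>\<bar>)"
        and le: "expectation (\<lambda>\<omega>. \<bar>X j \<omega> - Y j \<omega>\<bar>) \<le> C * real j powr (-4/5)" if "j \<in> {1..n}" for j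
        using expectation_cutoff_error_le[of j "X j" C] rv[of j] int3[of j] C[of j] that by (auto simp: Y_def)
      have "norm (expectation (SX n) - expectation (SY n)) = \<bar>expectation (\<lambda>\<omega>. SX n \<omega> - SY n \<omega>)\<bar>"
        using SX_int SY_int by simp
      also have "\<dots> \<le> expectation (\<lambda>\<omega>. \<bar>SX n \<omega> - SY n \<omega>\<bar>)" by (rule integral_abs_bound)
      also have "\<dots> \<le> expectation (\<lambda>\<omega>. c / sqrt (real n) * (\<Sum>j=1..n. \<bar>X j \<omega> - Y j \<omega>\<bar>))"
      proof (rule integral_mono)
        show "integrable M (\<lambda>\<omega>. c / sqrt (real n) * (\<Sum>j=1..n. \<bar>X j \<omega> - Y j \<omega>\<bar>))"
          by (intro integrable_mult_right Bochner_Integration.integrable_sum int)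
      qed (use SX_int SY_int perturb[OF elim] in auto)
      also have "\<dots> = c / sqrt (real n) * (\<Sum>j=1..n. expectation (\<lambda>\<omega>. \<bar>X j \<omega> - Y j \<omega>\<bar>))"
        using int by (subst integral_mult_right_zero, subst Bochner_Integration.integral_sum) auto
      also have "\<dots> \<le> c / sqrt (real n) * (\<Sum>j=1..n. real n powr (2/5) * (C * real j powr (-6/5)))"
      proof (intro mult_left_mono sum_mono)
        fix j assume j: "j \<in> {1..n}"
        \<comment> \<open>Trading \<open>j\<close> for \<open>n\<close> in one factor leaves a convergent series and the factor $n^{2/5}$, which $\sqrt n$ beats.\<close>
        have "real j powr (-4/5) = real j powr (2/5) * real j powr (-6/5)"
          by (simp add: powr_add[symmetric])
        also have "\<dots> \<le> real n powr (2/5) * real j powr (-6/5)"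
          using j by (intro mult_right_mono powr_mono2) auto
        finally have "C * real j powr (-4/5) \<le> C * (real n powr (2/5) * real j powr (-6/5))"
          using C0 by (rule mult_left_mono)
        with le[OF j] show "expectation (\<lambda>\<omega>. \<bar>X j \<omega> - Y j \<omega>\<bar>) \<le> real n powr (2/5) * (C * real j powr (-6/5))"
          by (simp add: mult_ac)
      qed (use c in simp)
      also have "\<dots> = c / sqrt (real n) * (real n powr (2/5) * (C * (\<Sum>j=1..n. real j powr (-6/5))))"
        by (simp only: sum_distrib_left)
      also have "\<dots> \<le> c / sqrt (real n) * (real n powr (2/5) * (C * K))"
        unfolding K_def using c C0
        by (intro mult_left_mono sum_le_suminf sm) auto
      finally show ?case .
    qed
    show "(\<lambda>n. c / sqrt (real n) * (real n powr (2/5) * (C * K))) \<longlonglongrightarrow> 0"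
      by real_asymp
  qed
  have mean_lim: "(\<lambda>n. expectation (SX n)) \<longlonglongrightarrow> \<gamma>"
    unfolding SX_def[abs_def] s_def \<gamma>_def
    by (rule step_mean_expectation_limit[OF indep int3 int2 int1 mean var C \<sigma> pq])
  have SY_hinge: "SY n \<omega> = 1 - (H n p \<omega> - H n q \<omega>) / (q - p)" if "n > 0" for n \<omega>
    unfolding SY_def H_def by (rule step_mean_hinge[OF that pq])
  have ESY_hinge: "expectation (SY n) = 1 - (expectation (H n p) - expectation (H n q)) / (q - p)" if n: "n > 0" for n
  proof -
    have "integrable M (H n u)" for u
      unfolding H_def[abs_def] by (rule hinge_mean_integrable[OF intY n])
    moreover have "SY n = (\<lambda>\<omega>. 1 - (H n p \<omega> - H n q \<omega>) / (q - p))"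
      using SY_hinge[OF n] by (simp add: fun_eq_iff)
    ultimately show ?thesis by (simp add: prob_space)
  qed
  have conc: "AE \<omega> in M. (\<lambda>n. H n u \<omega> - expectation (H n u)) \<longlonglongrightarrow> 0" for u
    unfolding H_def[abs_def] s_def Y_def by (rule hinge_mean_cutoff_AE[OF indep \<sigma>])
  have bounded: "AE \<omega> in M. \<exists>B. \<forall>n. (\<Sum>j=1..n. \<bar>X j \<omega> - Y j \<omega>\<bar>) \<le> B"
    unfolding Y_def by (rule cutoff_error_bounded_AE[OF rv int3 C])
  from conc[of p] conc[of q] bounded have "AE \<omega> in M. (\<lambda>n. SX n \<omega>) \<longlonglongrightarrow> \<gamma>"
  proof eventually_elim
    case (elim \<omega>)
    obtain B where B: "\<And>n. (\<Sum>j=1..n. \<bar>X j \<omega> - Y j \<omega>\<bar>) \<le> B" using elim(3) by blast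
    have "(\<lambda>n. SX n \<omega> - SY n \<omega>) \<longlonglongrightarrow> 0"
    proof (rule Lim_null_comparison)
      show "eventually (\<lambda>n. norm (SX n \<omega> - SY n \<omega>) \<le> c / sqrt (real n) * B) sequentially"
        using eventually_gt_at_top[of 0]
      proof eventually_elim
        case (elim n)
        have "c / sqrt (real n) * (\<Sum>j=1..n. \<bar>X j \<omega> - Y j \<omega>\<bar>) \<le> c / sqrt (real n) * B"
          using c by (intro mult_left_mono B) simp
        then show ?case using perturb[OF elim, of \<omega>] by simp
      qed
      show "(\<lambda>n. c / sqrt (real n) * B) \<longlonglongrightarrow> 0" by real_asymp
    qed
    moreover have "(\<lambda>n. SY n \<omega> - expectation (SY n)) \<longlonglongrightarrow> 0"
    proof (rule Lim_transform_eventually)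
      show "(\<lambda>n. - ((H n p \<omega> - expectation (H n p)) - (H n q \<omega> - expectation (H n q))) / (q - p)) \<longlonglongrightarrow> 0"
        using tendsto_divide[OF tendsto_minus[OF tendsto_diff[OF elim(1,2)]] tendsto_const[of "q - p"]] pq by simp
      show "eventually (\<lambda>n. - ((H n p \<omega> - expectation (H n p)) - (H n q \<omega> - expectation (H n q))) / (q - p)
          = SY n \<omega> - expectation (SY n)) sequentially"
        using eventually_gt_at_top[of 0]
        by eventually_elim (simp add: SY_hinge ESY_hinge diff_divide_distrib minus_divide_left[symmetric])
    qed
    ultimately have "(\<lambda>n. (SX n \<omega> - SY n \<omega>) + (SY n \<omega> - expectation (SY n))
        - (expectation (SX n) - expectation (SY n)) + expectation (SX n)) \<longlonglongrightarrow> 0 + 0 - 0 + \<gamma>"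
      by (intro tendsto_intros mean_diff mean_lim)
    then show ?case by simp
  qed
  then show ?thesis by (simp add: SX_def s_def \<gamma>_def)
qed

end

theorem corollary1p6:
  fixes M :: "'a measure" and X :: "nat \<Rightarrow> 'a \<Rightarrow> real" and m \<sigma> :: real
  assumes "prob_space M"
    and "prob_space.indep_vars M (\<lambda>_. borel) X {1..}"
    and "(SUP j\<in>{1..}. \<integral>\<^sup>+\<omega>. ennreal (\<bar>X j \<omega>\<bar> ^ 3) \<partial>M) < \<infinity>"
    and "\<And>j. j \<ge> 1 \<Longrightarrow> prob_space.expectation M (X j) = m"
    and "\<And>j. j \<ge> 1 \<Longrightarrow> prob_space.variance M (X j) = \<sigma>\<^sup>2"
    and "\<sigma> > 0"
  shows "AE \<omega> in M. weak_conv_m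
    (\<lambda>n. empirical_spectral_measure
            ((1 / (\<sigma> * sqrt (real n))) \<cdot>\<^sub>m sym_circulant n (\<lambda>j. X j \<omega>)))
    std_normal_distribution"
proof -
  interpret prob_space M by fact
  have rv: "random_variable borel (X j)" if "j \<ge> 1" for j
    using assms(2) that by (auto simp: indep_vars_def2)
  obtain C where C: "0 \<le> C" "(SUP j\<in>{1..}. \<integral>\<^sup>+\<omega>. ennreal (\<bar>X j \<omega>\<bar> ^ 3) \<partial>M) = ennreal C"
    using assms(3) unfolding infinity_ennreal_def less_top_ennreal by blast
  have moments: "integrable M (\<lambda>\<omega>. \<bar>X j \<omega>\<bar> ^ 3)" "expectation (\<lambda>\<omega>. \<bar>X j \<omega>\<bar> ^ 3) \<le> C"
    "integrable M (\<lambda>\<omega>. (X j \<omega>)\<^sup>2)" "integrable M (X j)" if j: "j \<ge> 1" for j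
  proof -
    have "(\<integral>\<^sup>+\<omega>. ennreal (\<bar>X j \<omega>\<bar> ^ 3) \<partial>M) \<le> ennreal C"
      unfolding C(2)[symmetric] using j by (intro SUP_upper) simp
    from third_moment_integrable[OF rv[OF j] this C(1)]
    show "integrable M (\<lambda>\<omega>. \<bar>X j \<omega>\<bar> ^ 3)" "expectation (\<lambda>\<omega>. \<bar>X j \<omega>\<bar> ^ 3) \<le> C"
      "integrable M (\<lambda>\<omega>. (X j \<omega>)\<^sup>2)" "integrable M (X j)" .
  qed
  have "AE \<omega> in M. \<forall>p\<in>\<rat>. \<forall>q\<in>\<rat>. p < q \<longrightarrow> (\<lambda>n. step_mean n (1 / (\<sigma> * sqrt (real n))) p q (\<lambda>j. X j \<omega>))
     \<longlonglongrightarrow> (\<integral>x. cts_step p q x \<partial>std_normal_distribution)"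
  proof (intro AE_ball_countable[THEN iffD2] countable_rat ballI)
    fix p q :: real
    show "AE \<omega> in M. p < q \<longrightarrow> (\<lambda>n. step_mean n (1 / (\<sigma> * sqrt (real n))) p q (\<lambda>j. X j \<omega>))
     \<longlonglongrightarrow> (\<integral>x. cts_step p q x \<partial>std_normal_distribution)"
    proof (cases "p < q")
      case True
      have "AE \<omega> in M. (\<lambda>n. step_mean n (1 / (\<sigma> * sqrt (real n))) p q (\<lambda>j. X j \<omega>))
          \<longlonglongrightarrow> (\<integral>x. cts_step p q x \<partial>std_normal_distribution)"
        by (rule step_mean_AE[OF assms(2) moments(1,3,4) assms(4,5) moments(2) assms(6) True])
      then show ?thesis by eventually_elim simp
    qed simp
  qed
  then show ?thesis
  proof eventually_elim
    case (elim \<omega>)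
    then show ?case
      by (intro weak_conv_if_step_means_converge real_dist_normal_dist) auto
  qed
qed

end
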